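(* Let $n\ge2$ and let $m_1<\cdots<m_n$ be a generalized arithmetic sequence of relatively prime positive integers, i.e. there exist $h,d\in\mathbb{Z}^+$ such that $m_i=h\,m_1+(i-1)d$ for all $i\in\{2,\ldots,n\}$ and $\gcd\{m_1,d\}=1$. Then $K[\mathcal{C}]$ is a Koszul algebra if and only if $m_1,\ldots,m_n$ are consecutive numbers and $n>m_1$.
   Context: $K$ is an infinite field and $R=K[x_1,\ldots,x_{n+1}]$ with its standard grading. For positive integers $m_1<\cdots<m_n$, the associated projective monomial curve $\mathcal{C}\subset\mathbb{P}^n_K$ is parametrically defined by $x_i=u^{m_i}v^{m_n-m_i}$ for $1\le i\le n$ and $x_{n+1}=v^{m_n}$. Its vanishing ideal $I(\mathcal{C})\subset R$ is the kernel of the $K$-algebra homomorphism $R\to K[u,v]$, $x_i\mapsto u^{m_i}v^{m_n-m_i}$ ($1\le i\le n$), $x_{n+1}\mapsto v^{m_n}$, and $K[\mathcal{C}]=R/I(\mathcal{C})$. $K[\mathcal{C}]$ is a Koszul algebra if its residue class field $K$ has a linear free resolution as a $K[\mathcal{C}]$-module. *)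

theory Defs
  imports "HOL-Algebra.QuotRing" "HOL-Algebra.Module" "HOL-Library.Poly_Mapping" "HOL-Library.FuncSet"
begin

section \<open>Polynomial rings\<close>

text \<open>A polynomial is a finitely supported map from monomials to coefficients; a monomial is
  the finitely supported map from variable indices to exponents.\<close>

type_synonym 'k mpol = "(nat \<Rightarrow>\<^sub>0 nat) \<Rightarrow>\<^sub>0 'k"

definition poly_ring :: "nat set \<Rightarrow> ('k::comm_ring_1) mpol ring" where
  "poly_ring V =
     \<lparr>carrier = {p. \<forall>s\<in>Poly_Mapping.keys p. Poly_Mapping.keys s \<subseteq> V},
      mult = (*), one = 1, zero = 0, add = (+)\<rparr>"

definition Var :: "nat \<Rightarrow> ('k::comm_ring_1) mpol" where
  "Var i = Poly_Mapping.single (Poly_Mapping.single i 1) 1"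

definition Const :: "'k \<Rightarrow> ('k::comm_ring_1) mpol" where
  "Const c = Poly_Mapping.single 0 c"

text \<open>The homomorphism of algebras over the coefficient ring that sends the variable with
  index \<open>i\<close> to \<open>f i\<close>.\<close>

definition poly_subst :: "(nat \<Rightarrow> 'k mpol) \<Rightarrow> 'k mpol \<Rightarrow> ('k::comm_ring_1) mpol" where
  "poly_subst f p =
     (\<Sum>s\<in>Poly_Mapping.keys p. Const (Poly_Mapping.lookup p s) *
        (\<Prod>i\<in>Poly_Mapping.keys s. f i ^ Poly_Mapping.lookup s i))"

definition mon_degree :: "(nat \<Rightarrow>\<^sub>0 nat) \<Rightarrow> nat" where
  "mon_degree s = (\<Sum>i\<in>Poly_Mapping.keys s. Poly_Mapping.lookup s i)"

definition poly_grading :: "nat set \<Rightarrow> nat \<Rightarrow> ('k::comm_ring_1) mpol set" where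
  "poly_grading V t =
     {p \<in> carrier (poly_ring V). \<forall>s\<in>Poly_Mapping.keys p. mon_degree s = t}"


section \<open>Graded modules and linear free resolutions\<close>

text \<open>A grading is the family of homogeneous components, indexed by \<^typ>\<open>nat\<close>: all rings and
  modules below live in nonnegative degrees.\<close>

definition quot_grading :: "'a ring \<Rightarrow> (nat \<Rightarrow> 'a set) \<Rightarrow> 'a set \<Rightarrow> nat \<Rightarrow> 'a set set" where
  "quot_grading R G I t = (\<lambda>p. I +>\<^bsub>R\<^esub> p) ` G t"

definition irrelevant_ideal :: "'a ring \<Rightarrow> (nat \<Rightarrow> 'a set) \<Rightarrow> 'a set" where
  "irrelevant_ideal A G = Idl\<^bsub>A\<^esub> (\<Union>t\<in>{0<..}. G t)"

definition residue_module :: "'a ring \<Rightarrow> 'a set \<Rightarrow> ('a, 'a set) module" where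
  "residue_module A I =
     \<lparr>carrier = carrier (A Quot I), mult = mult (A Quot I), one = one (A Quot I),
      zero = zero (A Quot I), add = add (A Quot I),
      smult = (\<lambda>a x. (I +>\<^bsub>A\<^esub> a) \<otimes>\<^bsub>A Quot I\<^esub> x)\<rparr>"

definition degree_zero_grading :: "('a, 'm) module \<Rightarrow> nat \<Rightarrow> 'm set" where
  "degree_zero_grading M t = (if t = 0 then carrier M else {\<zero>\<^bsub>M\<^esub>})"

text \<open>The free module of rank \<open>b\<close>, as extensional \<open>b\<close>-tuples. The \<open>mult\<close> and \<open>one\<close> fields,
  which the module record inherits from rings, play no role for modules.\<close>

definition free_module :: "'a ring \<Rightarrow> nat \<Rightarrow> ('a, nat \<Rightarrow> 'a) module" where
  "free_module A b =
     \<lparr>carrier = {..<b} \<rightarrow>\<^sub>E carrier A,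
      mult = (\<lambda>x y. \<lambda>j\<in>{..<b}. x j \<otimes>\<^bsub>A\<^esub> y j),
      one = (\<lambda>j\<in>{..<b}. \<one>\<^bsub>A\<^esub>),
      zero = (\<lambda>j\<in>{..<b}. \<zero>\<^bsub>A\<^esub>),
      add = (\<lambda>x y. \<lambda>j\<in>{..<b}. x j \<oplus>\<^bsub>A\<^esub> y j),
      smult = (\<lambda>a x. \<lambda>j\<in>{..<b}. a \<otimes>\<^bsub>A\<^esub> x j)\<rparr>"

text \<open>The grading of \<open>A(-i)\<^sup>b\<close>, whose component of degree \<open>t\<close> consists of the tuples with
  entries of degree \<open>t - i\<close>.\<close>

definition shifted_grading ::
  "'a ring \<Rightarrow> (nat \<Rightarrow> 'a set) \<Rightarrow> nat \<Rightarrow> nat \<Rightarrow> nat \<Rightarrow> (nat \<Rightarrow> 'a) set" where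
  "shifted_grading A G i b t =
     {..<b} \<rightarrow>\<^sub>E (if i \<le> t then G (t - i) else {\<zero>\<^bsub>A\<^esub>})"

definition mod_hom ::
  "'a ring \<Rightarrow> ('a, 'm) module \<Rightarrow> ('a, 'n) module \<Rightarrow> ('m \<Rightarrow> 'n) set" where
  "mod_hom A M N =
     {f \<in> carrier M \<rightarrow> carrier N.
        (\<forall>x\<in>carrier M. \<forall>y\<in>carrier M. f (x \<oplus>\<^bsub>M\<^esub> y) = f x \<oplus>\<^bsub>N\<^esub> f y) \<and>
        (\<forall>a\<in>carrier A. \<forall>x\<in>carrier M. f (a \<odot>\<^bsub>M\<^esub> x) = a \<odot>\<^bsub>N\<^esub> f x)}"

definition graded_hom ::
  "'a ring \<Rightarrow> ('a, 'm) module \<Rightarrow> (nat \<Rightarrow> 'm set) \<Rightarrow> ('a, 'n) module \<Rightarrow> (nat \<Rightarrow> 'n set) \<Rightarrow> ('m \<Rightarrow> 'n) set"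
  where
  "graded_hom A M GM N GN = {f \<in> mod_hom A M N. \<forall>t. f ` GM t \<subseteq> GN t}"

text \<open>A linear free resolution is an exact complex of graded modules and degree-preserving maps
  \<open>\<dots> \<rightarrow> A(-2)\<^bsup>b 2\<^esup> \<rightarrow> A(-1)\<^bsup>b 1\<^esup> \<rightarrow> A\<^bsup>b 0\<^esup> \<rightarrow> M \<rightarrow> 0\<close>; here \<open>d i\<close> is the map from step \<open>i + 1\<close>
  to step \<open>i\<close>.\<close>

definition is_linear_free_resolution ::
  "'a ring \<Rightarrow> (nat \<Rightarrow> 'a set) \<Rightarrow> ('a, 'm) module \<Rightarrow> (nat \<Rightarrow> 'm set) \<Rightarrow>
   (nat \<Rightarrow> nat) \<Rightarrow> (nat \<Rightarrow> (nat \<Rightarrow> 'a) \<Rightarrow> (nat \<Rightarrow> 'a)) \<Rightarrow> ((nat \<Rightarrow> 'a) \<Rightarrow> 'm) \<Rightarrow> bool" where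
  "is_linear_free_resolution A G M GM b d e \<longleftrightarrow>
     (let F = (\<lambda>i. free_module A (b i)); GF = (\<lambda>i. shifted_grading A G i (b i)) in
        e \<in> graded_hom A (F 0) (GF 0) M GM \<and>
        (\<forall>i. d i \<in> graded_hom A (F (Suc i)) (GF (Suc i)) (F i) (GF i)) \<and>
        e ` carrier (F 0) = carrier M \<and>
        d 0 ` carrier (F 1) = a_kernel (F 0) M e \<and>
        (\<forall>i. d (Suc i) ` carrier (F (Suc (Suc i))) = a_kernel (F (Suc i)) (F i) (d i)))"

definition has_linear_free_resolution ::
  "'a ring \<Rightarrow> (nat \<Rightarrow> 'a set) \<Rightarrow> ('a, 'm) module \<Rightarrow> (nat \<Rightarrow> 'm set) \<Rightarrow> bool" where
  "has_linear_free_resolution A G M GM \<longleftrightarrow> (\<exists>b d e. is_linear_free_resolution A G M GM b d e)"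

definition residue_class_field :: "'a ring \<Rightarrow> (nat \<Rightarrow> 'a set) \<Rightarrow> ('a, 'a set) module" where
  "residue_class_field A G = residue_module A (irrelevant_ideal A G)"

definition koszul_algebra :: "'a ring \<Rightarrow> (nat \<Rightarrow> 'a set) \<Rightarrow> bool" where
  "koszul_algebra A G \<longleftrightarrow>
     has_linear_free_resolution A G
       (residue_class_field A G) (degree_zero_grading (residue_class_field A G))"


section \<open>Projective monomial curves\<close>

text \<open>In the target ring, \<open>u\<close> is the variable with index 0 and \<open>v\<close> the one with index 1.\<close>

definition curve_param :: "nat \<Rightarrow> (nat \<Rightarrow> nat) \<Rightarrow> nat \<Rightarrow> ('k::comm_ring_1) mpol" where
  "curve_param n m i =
     (if i \<in> {1..n} then Var 0 ^ m i * Var 1 ^ (m n - m i) else Var 1 ^ m n)"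

definition curve_ideal :: "nat \<Rightarrow> (nat \<Rightarrow> nat) \<Rightarrow> ('k::comm_ring_1) mpol set" where
  "curve_ideal n m =
     a_kernel (poly_ring {1..n + 1}) (poly_ring {0, 1}) (poly_subst (curve_param n m))"

definition curve_algebra :: "nat \<Rightarrow> (nat \<Rightarrow> nat) \<Rightarrow> ('k::comm_ring_1) mpol set ring" where
  "curve_algebra n m = poly_ring {1..n + 1} Quot curve_ideal n m"

definition curve_grading :: "nat \<Rightarrow> (nat \<Rightarrow> nat) \<Rightarrow> nat \<Rightarrow> ('k::comm_ring_1) mpol set set" where
  "curve_grading n m =
     quot_grading (poly_ring {1..n + 1}) (poly_grading {1..n + 1}) (curve_ideal n m)"

definition generalized_arithmetic_sequence :: "nat \<Rightarrow> (nat \<Rightarrow> nat) \<Rightarrow> bool" where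
  "generalized_arithmetic_sequence n m \<longleftrightarrow>
     (\<exists>h d. h > 0 \<and> d > 0 \<and> (\<forall>i\<in>{2..n}. m i = h * m 1 + (i - 1) * d) \<and> gcd (m 1) d = 1)"

end

theory Submission
  imports Defs "HOL-Library.Product_Plus" "HOL-Library.Multiset"
begin

text \<open>Put \<open>E = {0, m 1, \<dots>, m n}\<close>. The curve algebra is the semigroup algebra of the set of
  pairs \<open>(x, t)\<close> with \<open>x\<close> a sum of \<open>t\<close> elements of \<open>E\<close>, graded by \<open>t\<close>. In the consecutive case
  with \<open>D = m n\<close> and \<open>a = m 1\<close>, where \<open>D \<ge> 2 * a\<close>, the variables have a Koszul filtration: the elements
  \<open>x_0, x_D\<close> form a regular sequence, and modulo them \<open>x_a\<close> is a Conca generator (its square is 0 and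
  its multiples fill degree 2, the last nonzero one), so that \<open>0\<close>, \<open>(x_0)\<close>, \<open>(x_0, x_D)\<close> and all
  ideals of variables containing \<open>x_0, x_D, x_a\<close> are closed under the successive colons.
  Conversely, if the residue field has a linear resolution then the linear syzygies of the variables
  generate all syzygies, so that any two factorizations of a monomial are connected by quadratic
  exchanges. In the remaining cases some factorization cannot be reached in this way: either the
  number of factors \<open>x_0\<close> is invariant, or a monomial such as \<open>x_a^h x_{m 3}\<close> admits no exchange
  although it has the second factorization \<open>x_{m 2}^2 x_0^{h - 1}\<close>.\<close>

text \<open>Both directions turn on the relation \<open>x_a^2 = x_0 x_(2a)\<close>. For
  \<open>E = insert 0 {a..D}\<close> the bound \<open>2 * a <= D\<close> says that
  \<open>2 * a\<close> lies in \<open>E\<close>: this kills the square of \<open>x_a\<close> modulo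
  \<open>x_0\<close> and puts \<open>a\<close> among the variables that generate the colon by
  \<open>x_a\<close>. Conversely, connectedness by quadratic exchanges forces some relation
  \<open>x = y + z\<close> between positive elements of \<open>E\<close>; for \<open>h = 1\<close>
  such a relation shows that \<open>d\<close> divides \<open>a\<close> and that
  \<open>a < n\<close>.

  A linear resolution is here a sequence of explicit maps over a quotient of a polynomial ring. The
  work is moved to the semigroup algebra, where ideals of variables are spanned by monomials and
  every colon becomes a question about pairs of numbers. In the converse the bases of the given
  resolution are unknown, and the rows of its first matrix are arbitrary linear forms. Constants
  that express the variables through these rows replace a normal form of the resolution, and a
  linear functional detects syzygies that are not generated by linear ones.\<close>

abbreviation (input) "lookup \<equiv> Poly_Mapping.lookup"
abbreviation (input) "keys \<equiv> Poly_Mapping.keys"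
abbreviation (input) "single \<equiv> Poly_Mapping.single"

section \<open>Finitely supported functions: linear extension and push-forward\<close>

lemma poly_mapping_sum_single:
  fixes p :: "'a \<Rightarrow>\<^sub>0 'b::comm_monoid_add"
  shows "p = (\<Sum>s\<in>keys p. single s (lookup p s))"
proof (rule poly_mapping_eqI)
  fix k
  have "(\<Sum>s\<in>keys p. lookup (single s (lookup p s)) k)
      = (\<Sum>s\<in>keys p. if s = k then lookup p k else 0)"
    by (intro sum.cong) (auto simp: lookup_single when_def)
  then show "lookup p k = lookup (\<Sum>s\<in>keys p. single s (lookup p s)) k"
    by (auto simp: lookup_sum in_keys_iff)
qed

lemma poly_mapping_single_induct [case_names zero add]:
  fixes p :: "'a \<Rightarrow>\<^sub>0 'b::comm_monoid_add"
  assumes "P 0"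
    and "\<And>s c q. P q \<Longrightarrow> s \<in> keys p \<Longrightarrow> P (single s c + q)"
  shows "P p"
proof -
  have "P (\<Sum>s\<in>X. single s (lookup p s))" if "finite X" "X \<subseteq> keys p" for X
    using that by (induction X) (auto intro: assms)
  from this[of "keys p"] show ?thesis
    by (simp flip: poly_mapping_sum_single)
qed

text \<open>Semiring coefficients are allowed so that the same functional also gives the weight and
  the degree of an exponent vector over the natural numbers.\<close>

definition extend_lin :: "('a \<Rightarrow> 'k) \<Rightarrow> ('a \<Rightarrow>\<^sub>0 'k) \<Rightarrow> ('k::comm_semiring_1)" where
  "extend_lin f p = (\<Sum>s\<in>keys p. lookup p s * f s)"

lemma extend_lin_superset:
  "finite X \<Longrightarrow> keys p \<subseteq> X \<Longrightarrow> extend_lin f p = (\<Sum>s\<in>X. lookup p s * f s)"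
  unfolding extend_lin_def
  by (rule sum.mono_neutral_left) (auto simp: in_keys_iff)

lemma extend_lin_add [simp]: "extend_lin f (p + q) = extend_lin f p + extend_lin f q"
proof -
  have *: "keys (p + q) \<subseteq> keys p \<union> keys q" by (rule keys_add)
  show ?thesis
    unfolding extend_lin_superset[OF _ *, simplified]
      extend_lin_superset[of "keys p \<union> keys q" p, simplified]
      extend_lin_superset[of "keys p \<union> keys q" q, simplified]
    by (simp add: lookup_add distrib_right sum.distrib)
qed

lemma extend_lin_single [simp]: "extend_lin f (single s c) = c * f s"
  by (cases "c = 0") (simp_all add: extend_lin_def)

lemma extend_lin_zero [simp]: "extend_lin f 0 = 0"
  by (simp add: extend_lin_def)

lemma extend_lin_sum [simp]: "extend_lin f (sum g X) = (\<Sum>x\<in>X. extend_lin f (g x))"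
  by (induction X rule: infinite_finite_induct) auto

lemma extend_lin_uminus [simp]:
  fixes f :: "'a \<Rightarrow> 'k::comm_ring_1"
  shows "extend_lin f (- p) = - extend_lin f p"
  using extend_lin_add[of f p "- p"] by (simp add: eq_neg_iff_add_eq_0 add.commute)

text \<open>For additive \<open>h\<close> this is the homomorphism of semigroup algebras induced by
  \<open>h\<close>; for a section of such a map it chooses preimages term by term.\<close>

definition push :: "('a \<Rightarrow> 'b) \<Rightarrow> ('a \<Rightarrow>\<^sub>0 'k) \<Rightarrow> ('b \<Rightarrow>\<^sub>0 'k::comm_ring_1)" where
  "push h p = (\<Sum>s\<in>keys p. single (h s) (lookup p s))"

lemma lookup_push: "lookup (push h p) t = extend_lin (\<lambda>s. if h s = t then 1 else 0) p"
  unfolding push_def extend_lin_def lookup_sum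
  by (intro sum.cong) (auto simp: lookup_single when_def)

lemma push_add [simp]: "push h (p + q) = push h p + push h q"
  by (rule poly_mapping_eqI) (simp add: lookup_push lookup_add)

lemma push_zero [simp]: "push h 0 = 0"
  by (simp add: push_def)

lemma push_single [simp]: "push h (single s c) = single (h s) c"
  by (cases "c = 0") (simp_all add: push_def)

lemma push_mult:
  fixes h :: "'a::comm_monoid_add \<Rightarrow> 'b::comm_monoid_add"
  assumes "\<And>s t. h (s + t) = h s + h t"
  shows "push h (p * q) = push h p * push h q"
proof (induction p rule: poly_mapping_single_induct)
  case (add s c p)
  have "push h (single s c * q) = single (h s) c * push h q"
    by (induction q rule: poly_mapping_single_induct) (auto simp: distrib_left mult_single assms)
  with add.IH show ?case by (simp add: distrib_right)
qed simp

lemma push_comp: "push g (push h p) = push (g \<circ> h) p"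
  by (induction p rule: poly_mapping_single_induct) auto

lemma push_cong: "(\<And>s. s \<in> keys p \<Longrightarrow> g s = h s) \<Longrightarrow> push g p = push h p"
  unfolding push_def by (intro sum.cong) auto

lemma push_id [simp]: "push (\<lambda>s. s) p = p"
  by (induction p rule: poly_mapping_single_induct) auto

lemma keys_push: "keys (push h p) \<subseteq> h ` keys p"
  unfolding push_def by (rule subset_trans[OF keys_sum])
    (auto split: if_splits)

lemma push_eq_0_iff:
  assumes "inj_on g (keys p)"
  shows "push g p = 0 \<longleftrightarrow> p = 0"
proof
  assume "push g p = 0"
  then have "push (inv_into (keys p) g) (push g p) = 0" by simp
  moreover have "push (inv_into (keys p) g) (push g p) = push (\<lambda>s. s) p"
    unfolding push_comp using assms by (intro push_cong) auto
  ultimately show "p = 0" by simp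
qed simp

section \<open>Koszul filtrations\<close>

text \<open>The ring is a subset of a type of class \<open>comm_ring_1\<close>, which keeps the
  arithmetic of the class available; ring records enter only through an isomorphism. The map
  \<open>cmp t\<close> is the projection to the component of degree \<open>t\<close>, and
  multiplication by a linear form shifts these projections by one.\<close>

locale graded_subring =
  fixes A :: "'r::comm_ring_1 set" and H :: "nat \<Rightarrow> 'r set" and cmp :: "nat \<Rightarrow> 'r \<Rightarrow> 'r"
  assumes one_mem_H: "1 \<in> H 0"
    and uminus_mem: "x \<in> A \<Longrightarrow> - x \<in> A"
    and add_mem: "x \<in> A \<Longrightarrow> y \<in> A \<Longrightarrow> x + y \<in> A"
    and mult_mem: "x \<in> A \<Longrightarrow> y \<in> A \<Longrightarrow> x * y \<in> A"
    and H_subset: "H t \<subseteq> A"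
    and zero_mem_H: "0 \<in> H t"
    and add_mem_H: "x \<in> H t \<Longrightarrow> y \<in> H t \<Longrightarrow> x + y \<in> H t"
    and mult_mem_H: "x \<in> H s \<Longrightarrow> y \<in> H t \<Longrightarrow> x * y \<in> H (s + t)"
    and cmp_mem: "x \<in> A \<Longrightarrow> cmp t x \<in> H t"
    and cmp_id: "x \<in> H t \<Longrightarrow> cmp t x = x"
    and cmp_add: "cmp t (x + y) = cmp t x + cmp t y"
    and cmp_mult: "x \<in> A \<Longrightarrow> y \<in> H 1 \<Longrightarrow> cmp (Suc t) (x * y) = cmp t x * y"
begin

lemma one_mem: "1 \<in> A"
  using one_mem_H H_subset by blast

lemma zero_mem: "0 \<in> A"
  using zero_mem_H H_subset by blast

lemma sum_mem: "(\<And>x. x \<in> X \<Longrightarrow> f x \<in> A) \<Longrightarrow> sum f X \<in> A"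
  by (induction X rule: infinite_finite_induct) (auto intro: zero_mem add_mem)

lemma sum_mem_H: "(\<And>x. x \<in> X \<Longrightarrow> f x \<in> H t) \<Longrightarrow> sum f X \<in> H t"
  by (induction X rule: infinite_finite_induct) (auto intro: zero_mem_H add_mem_H)

lemma cmp_zero: "cmp t 0 = 0"
  by (rule cmp_id[OF zero_mem_H])

lemma cmp_sum: "cmp t (sum f X) = (\<Sum>x\<in>X. cmp t (f x))"
  by (induction X rule: infinite_finite_induct) (auto simp: cmp_zero cmp_add)

text \<open>Tuples over \<open>A\<close> are functions on \<^typ>\<open>nat\<close> that vanish from the rank of the free module on.\<close>

definition comb :: "(nat \<Rightarrow> 'r) list \<Rightarrow> (nat \<Rightarrow> 'r) \<Rightarrow> nat \<Rightarrow> 'r" where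
  "comb gs c j = (\<Sum>k<length gs. c k * (gs ! k) j)"

definition vspan :: "(nat \<Rightarrow> 'r) list \<Rightarrow> (nat \<Rightarrow> 'r) set" where
  "vspan gs = {comb gs c |c. \<forall>k. c k \<in> A}"

definition syz :: "(nat \<Rightarrow> 'r) list \<Rightarrow> (nat \<Rightarrow> 'r) set" where
  "syz gs = {a. (\<forall>k. a k \<in> A) \<and> (\<forall>k\<ge>length gs. a k = 0) \<and> (\<forall>j. comb gs a j = 0)}"

definition ideal_span :: "'r list \<Rightarrow> 'r set" where
  "ideal_span xs = {\<Sum>k<length xs. c k * xs ! k |c. \<forall>k. c k \<in> A}"

definition colon :: "'r set \<Rightarrow> 'r \<Rightarrow> 'r set" where
  "colon J x = {a \<in> A. a * x \<in> J}"

text \<open>The free module is filtered by the number of coordinates. This is the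
  \<open>k\<close>-th quotient of the induced filtration on \<open>N\<close>, regarded as an ideal
  of \<open>A\<close>.\<close>

definition lead :: "(nat \<Rightarrow> 'r) set \<Rightarrow> nat \<Rightarrow> 'r set" where
  "lead N k = {a k |a. a \<in> N \<and> (\<forall>j>k. a j = 0)}"

text \<open>Closure under the component of degree 1 is what turns an arbitrary lift of a linear
  leading entry into one whose entries are all linear.\<close>

definition graded_submodule :: "(nat \<Rightarrow> 'r) set \<Rightarrow> bool" where
  "graded_submodule N \<longleftrightarrow>
     (\<forall>a\<in>N. \<forall>j. a j \<in> A) \<and> (\<lambda>_. 0) \<in> N \<and> (\<forall>a\<in>N. \<forall>a'\<in>N. (\<lambda>j. a j + a' j) \<in> N) \<and>
     (\<forall>c\<in>A. \<forall>a\<in>N. (\<lambda>j. c * a j) \<in> N) \<and> (\<forall>a\<in>N. (\<lambda>j. cmp 1 (a j)) \<in> N)"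

lemma ideal_span_add:
  assumes "x \<in> ideal_span ys" "y \<in> ideal_span ys"
  shows "x + y \<in> ideal_span ys"
proof -
  from assms obtain c d where "\<forall>k. c k \<in> A" "x = (\<Sum>k<length ys. c k * ys ! k)"
    "\<forall>k. d k \<in> A" "y = (\<Sum>k<length ys. d k * ys ! k)"
    by (auto simp: ideal_span_def)
  then show ?thesis
    unfolding ideal_span_def
    by (intro CollectI exI[of _ "\<lambda>k. c k + d k"]) (auto simp: distrib_right sum.distrib add_mem)
qed

lemma ideal_span_mult:
  assumes "x \<in> ideal_span ys" "a \<in> A"
  shows "a * x \<in> ideal_span ys"
proof -
  from assms obtain c where "\<forall>k. c k \<in> A" "x = (\<Sum>k<length ys. c k * ys ! k)"
    by (auto simp: ideal_span_def)
  then show ?thesis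
    unfolding ideal_span_def using assms
    by (intro CollectI exI[of _ "\<lambda>k. a * c k"]) (auto simp: sum_distrib_left mult.assoc mult_mem)
qed

lemma zero_mem_ideal_span: "0 \<in> ideal_span ys"
  unfolding ideal_span_def by (intro CollectI exI[of _ "\<lambda>_. 0"]) (simp add: zero_mem)

lemma ideal_span_nth:
  assumes "l < length ys"
  shows "ys ! l \<in> ideal_span ys"
proof -
  have "(\<Sum>i<length ys. (if i = l then 1 else 0) * ys ! i) = (\<Sum>i<length ys. if i = l then ys ! l else 0)"
    by (intro sum.cong) auto
  then have "(\<Sum>i<length ys. (if i = l then 1 else 0) * ys ! i) = ys ! l"
    using assms by simp
  then show ?thesis
    unfolding ideal_span_def
    by (intro CollectI exI[of _ "\<lambda>i. if i = l then 1 else 0"]) (auto simp: one_mem zero_mem)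
qed

lemma ideal_span_subset:
  assumes "set ys \<subseteq> A"
  shows "ideal_span ys \<subseteq> A"
proof
  fix z assume "z \<in> ideal_span ys"
  then obtain c where c: "\<forall>k. c k \<in> A" "z = (\<Sum>k<length ys. c k * ys ! k)"
    by (auto simp: ideal_span_def)
  have "ys ! k \<in> A" if "k < length ys" for k
    using nth_mem[OF that] assms by blast
  with c show "z \<in> A" by (auto intro!: sum_mem mult_mem)
qed

lemma comb_append:
  "comb (gs @ hs) c j = comb gs c j + comb hs (\<lambda>k. c (length gs + k)) j"
proof -
  have "(\<Sum>k<length gs + l. f k) = (\<Sum>k<length gs. f k) + (\<Sum>k<l. f (length gs + k))"
    for f :: "nat \<Rightarrow> 'r" and l
    by (induction l) (auto simp: add.assoc)
  then show ?thesis
    unfolding comb_def length_append by (simp add: nth_append)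
qed

lemma comb_cong:
  "(\<And>k. k < length gs \<Longrightarrow> c k = c' k) \<Longrightarrow> comb gs c j = comb gs c' j"
  unfolding comb_def by (intro sum.cong) auto

lemma comb_zero: "(\<And>k. k < length gs \<Longrightarrow> c k = 0) \<Longrightarrow> comb gs c j = 0"
  unfolding comb_def by (intro sum.neutral) auto

lemma comb_mem:
  assumes N: "graded_submodule N" and gs: "set gs \<subseteq> N" and c: "\<forall>k. c k \<in> A"
  shows "comb gs c \<in> N"
proof -
  have "(\<lambda>j. \<Sum>k<l. c k * (gs ! k) j) \<in> N" if "l \<le> length gs" for l
    using that
  proof (induction l)
    case 0
    then show ?case using N by (simp add: graded_submodule_def)
  next
    case (Suc l)
    then have "gs ! l \<in> N" using gs by auto
    then have "(\<lambda>j. c l * (gs ! l) j) \<in> N"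
      using N c by (auto simp: graded_submodule_def)
    then show ?case
      using N Suc unfolding graded_submodule_def sum.lessThan_Suc by auto
  qed
  then show ?thesis unfolding comb_def[abs_def] by auto
qed

text \<open>As the entries of \<open>gs\<close> are linear, the degree 2 component of a combination
  is the combination with the degree 1 components of the coefficients, so these again form a
  syzygy.\<close>

lemma syz_graded_submodule:
  assumes "\<And>g j. g \<in> set gs \<Longrightarrow> g j \<in> H 1"
  shows "graded_submodule (syz gs)"
proof -
  have "(\<lambda>k. cmp 1 (a k)) \<in> syz gs" if a: "a \<in> syz gs" for a
  proof -
    have "comb gs (\<lambda>k. cmp 1 (a k)) j = cmp (Suc 1) (comb gs a j)" for j
      unfolding comb_def cmp_sum using a assms
      by (intro sum.cong refl cmp_mult[symmetric]) (auto simp: syz_def)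
    moreover have "cmp 1 (a k) \<in> A" for k
      using a cmp_mem H_subset by (force simp: syz_def)
    ultimately show ?thesis
      using a by (auto simp: syz_def cmp_zero)
  qed
  moreover have "comb gs (\<lambda>k. a k + a' k) j = comb gs a j + comb gs a' j"
    "comb gs (\<lambda>k. c * a k) j = c * comb gs a j" for a a' c j
    unfolding comb_def by (auto simp: distrib_right sum.distrib sum_distrib_left mult.assoc)
  moreover have "comb gs (\<lambda>_. 0) j = 0" for j
    by (rule comb_zero) simp
  ultimately show ?thesis
    unfolding graded_submodule_def
    by (auto simp: syz_def zero_mem intro: add_mem mult_mem)
qed

end

text \<open>The ideals of the filtration are given by ordered lists of generators, because the colon
  condition refers to their initial segments.\<close>

locale koszul_filtration = graded_subring A H cmp
  for A :: "'r::comm_ring_1 set" and H cmp +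
  fixes F :: "'r list set"
  assumes F_linear: "xs \<in> F \<Longrightarrow> set xs \<subseteq> H 1"
    and F_colon: "xs \<in> F \<Longrightarrow> l < length xs \<Longrightarrow>
      \<exists>ys\<in>F. ideal_span ys = colon (ideal_span (take l xs)) (xs ! l)"
begin

text \<open>Lifts to \<open>N\<close> of the generators \<open>y\<^sub>1, y\<^sub>2, \<dots>\<close> of its leading ideals generate \<open>N\<close>, and the
  leading ideals of their syzygies are the colons \<open>(y\<^sub>1, \<dots>, y\<^bsub>l - 1\<^esub>) : y\<^sub>l\<close>. So the condition on
  leading ideals passes from \<open>N\<close> to the next syzygy module.\<close>

lemma generators_up_to:
  assumes N: "graded_submodule N"
    and lead: "\<And>k. k < b \<Longrightarrow> \<exists>ys\<in>F. lead N k = ideal_span ys"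
    and "k \<le> b"
  shows "\<exists>gs. (\<forall>g\<in>set gs. g \<in> N \<and> (\<forall>j. g j \<in> H 1) \<and> (\<forall>j\<ge>k. g j = 0)) \<and>
    {a \<in> N. \<forall>j\<ge>k. a j = 0} \<subseteq> vspan gs \<and>
    (\<forall>p<length gs. \<exists>ys\<in>F. lead (syz gs) p = ideal_span ys)"
  using \<open>k \<le> b\<close>
proof (induction k)
  case 0
  have "(\<lambda>_. 0) \<in> vspan []"
    unfolding vspan_def
    by (intro CollectI exI[of _ "\<lambda>_. 0"]) (auto simp: comb_def zero_mem)
  moreover have "a = (\<lambda>_. 0)" if "\<forall>j\<ge>0. a j = 0" for a :: "nat \<Rightarrow> 'r" using that by auto
  ultimately show ?case by (intro exI[of _ "[]"]) auto
next
  case (Suc k)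
  from Suc.IH Suc_leD[OF Suc.prems] obtain gs
    where IH: "\<forall>g\<in>set gs. g \<in> N \<and> (\<forall>j. g j \<in> H 1) \<and> (\<forall>j\<ge>k. g j = 0)"
      "{a \<in> N. \<forall>j\<ge>k. a j = 0} \<subseteq> vspan gs"
      "\<forall>p<length gs. \<exists>ys\<in>F. lead (syz gs) p = ideal_span ys"
    by blast
  have gs: "\<And>g. g \<in> set gs \<Longrightarrow> g \<in> N" "\<And>g j. g \<in> set gs \<Longrightarrow> g j \<in> H 1"
      "\<And>g j. g \<in> set gs \<Longrightarrow> j \<ge> k \<Longrightarrow> g j = 0"
    using IH(1) by simp_all
  note span_gs = IH(2)
  have lead_gs: "\<And>p. p < length gs \<Longrightarrow> \<exists>ys\<in>F. lead (syz gs) p = ideal_span ys"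
    using IH(3) by simp
  obtain ys where ys: "ys \<in> F" and lead_ys: "lead N k = ideal_span ys"
    using lead[of k] Suc.prems by (meson Suc_le_lessD)
  \<comment> \<open>Any lift of \<open>ys ! l\<close> is replaced by its component of degree 1:
    coordinate \<open>k\<close> is linear already and stays, the other entries become
    linear.\<close>
  have "\<exists>v\<in>N. v k = ys ! l \<and> (\<forall>j>k. v j = 0) \<and> (\<forall>j. v j \<in> H 1)" if "l < length ys" for l
  proof -
    have "ys ! l \<in> ideal_span ys" using that by (rule ideal_span_nth)
    then obtain a where a: "a \<in> N" "\<forall>j>k. a j = 0" "a k = ys ! l"
      unfolding lead_ys[symmetric] lead_def by auto
    moreover have "ys ! l \<in> H 1" using that ys F_linear by fastforce
    ultimately show ?thesis
      using N by (intro bexI[of _ "\<lambda>j. cmp 1 (a j)"])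
        (auto simp: graded_submodule_def cmp_id cmp_zero intro: cmp_mem)
  qed
  then obtain v where v: "\<And>l. l < length ys \<Longrightarrow> v l \<in> N" "\<And>l. l < length ys \<Longrightarrow> v l k = ys ! l"
    "\<And>l j. l < length ys \<Longrightarrow> j > k \<Longrightarrow> v l j = 0" "\<And>l j. l < length ys \<Longrightarrow> v l j \<in> H 1"
    by metis
  define vs where "vs = map v [0..<length ys]"
  have len_vs: "length vs = length ys" by (simp add: vs_def)
  have vs: "set vs \<subseteq> N" using v by (auto simp: vs_def)
  have comb_vs_k: "comb vs e k = (\<Sum>l<length ys. e l * ys ! l)" for e
    unfolding comb_def len_vs by (intro sum.cong) (simp_all add: vs_def v(2))
  have comb_vs_gt: "comb vs e j = 0" if "j > k" for e j
    unfolding comb_def len_vs using that by (intro sum.neutral) (simp add: vs_def v(3))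
  have comb_gs_ge: "comb gs e j = 0" if "j \<ge> k" for e j
    unfolding comb_def using gs(3)[OF nth_mem that] by (intro sum.neutral) simp
  \<comment> \<open>Subtracting the combination of \<open>vs\<close> with coefficients
    \<open>e\<close> clears coordinate \<open>k\<close>, and \<open>gs\<close> accounts for the
    remainder. The coefficients on \<open>vs\<close> are exactly the prescribed ones; the
    computation of the leading ideals relies on this.\<close>
  have reduce: "\<exists>c. (\<forall>q. c q \<in> A) \<and> a = comb (gs @ vs) c \<and>
      (\<forall>l. c (length gs + l) = e l)"
    if a: "a \<in> N" "\<forall>j>k. a j = 0" and e: "\<forall>l. e l \<in> A" and eq: "a k = (\<Sum>l<length ys. e l * ys ! l)"
    for a e
  proof -
    have "comb vs (\<lambda>l. - e l) \<in> N" using e by (intro comb_mem[OF N vs]) (auto intro: uminus_mem)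
    with a N have "(\<lambda>j. a j + comb vs (\<lambda>l. - e l) j) \<in> N"
      unfolding graded_submodule_def by blast
    moreover have "a j + comb vs (\<lambda>l. - e l) j = 0" if "j \<ge> k" for j
      using that a comb_vs_gt[of j] by (cases "j = k") (auto simp: comb_vs_k eq sum_negf)
    ultimately obtain c where c: "\<forall>q. c q \<in> A" "(\<lambda>j. a j + comb vs (\<lambda>l. - e l) j) = comb gs c"
      using span_gs unfolding vspan_def by blast
    define c' where "c' = (\<lambda>q. if q < length gs then c q else e (q - length gs))"
    have "a j = comb (gs @ vs) c' j" for j
    proof -
      have "comb gs c' j = comb gs c j" by (rule comb_cong) (auto simp: c'_def)
      then have "comb gs c' j = a j + comb vs (\<lambda>l. - e l) j" by (simp flip: c(2))
      moreover have "comb vs (\<lambda>l. - e l) j = - comb vs e j" by (simp add: comb_def sum_negf)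
      ultimately show ?thesis by (simp add: comb_append c'_def)
    qed
    then show ?thesis using c e by (intro exI[of _ c']) (auto simp: c'_def)
  qed
  have "\<exists>zs\<in>F. lead (syz (gs @ vs)) p = ideal_span zs" if p: "p < length (gs @ vs)" for p
  proof (cases "p < length gs")
    case True
    \<comment> \<open>A coefficient vector that vanishes beyond \<open>p\<close> does not involve
      \<open>vs\<close>, so the leading ideals at the old places persist.\<close>
    have "a \<in> syz (gs @ vs) \<longleftrightarrow> a \<in> syz gs" if "\<forall>j>p. a j = 0" for a
    proof -
      have "comb vs (\<lambda>l. a (length gs + l)) j = 0" for j
        using that True by (intro comb_zero) auto
      then show ?thesis using that True by (auto simp: syz_def comb_append)
    qed
    then have "lead (syz (gs @ vs)) p = lead (syz gs) p" unfolding lead_def by blast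
    with lead_gs[OF True] show ?thesis by simp
  next
    case False
    define l where "l = p - length gs"
    have l: "p = length gs + l" "l < length ys" using False p len_vs by (auto simp: l_def)
    have "lead (syz (gs @ vs)) p = colon (ideal_span (take l ys)) (ys ! l)"
    proof (intro equalityI subsetI)
      fix x assume "x \<in> lead (syz (gs @ vs)) p"
      then obtain a where a: "a \<in> syz (gs @ vs)" "\<forall>j>p. a j = 0" "x = a p"
        unfolding lead_def by auto
      define e where "e = (\<lambda>i. a (length gs + i))"
      \<comment> \<open>At coordinate \<open>k\<close> the old generators vanish, so a syzygy
        becomes a relation among \<open>ys\<close>, whose last term lies in the ideal of the
        preceding ones.\<close>
      have "comb (gs @ vs) a k = 0" using a by (simp add: syz_def)
      then have "(\<Sum>i<length ys. e i * ys ! i) = 0"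
        by (simp add: comb_append comb_gs_ge comb_vs_k e_def)
      also have "(\<Sum>i<length ys. e i * ys ! i) = (\<Sum>i<Suc l. e i * ys ! i)"
        using a l by (intro sum.mono_neutral_right) (auto simp: e_def)
      finally have "e l * ys ! l = (\<Sum>i<l. - e i * ys ! i)"
        by (simp add: sum_negf eq_neg_iff_add_eq_0 add.commute)
      also have "\<dots> = (\<Sum>i<length (take l ys). - e i * take l ys ! i)"
        using l by (intro sum.cong) auto
      also have "\<dots> \<in> ideal_span (take l ys)"
        unfolding ideal_span_def using a
        by (intro CollectI exI[of _ "\<lambda>i. - e i"]) (auto simp: e_def syz_def intro: uminus_mem)
      finally show "x \<in> colon (ideal_span (take l ys)) (ys ! l)"
        using a l by (auto simp: colon_def e_def syz_def)
    next
      fix x assume "x \<in> colon (ideal_span (take l ys)) (ys ! l)"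
      then obtain c where x: "x \<in> A" and c: "\<forall>i. c i \<in> A"
        and "x * ys ! l = (\<Sum>i<length (take l ys). c i * take l ys ! i)"
        unfolding colon_def ideal_span_def by auto
      moreover have "(\<Sum>i<length (take l ys). c i * take l ys ! i) = (\<Sum>i<l. c i * ys ! i)"
        using l by (intro sum.cong) auto
      ultimately have eq: "x * ys ! l = (\<Sum>i<l. c i * ys ! i)" by simp
      \<comment> \<open>The membership of \<open>x\<close> in the colon, written as a relation among
        \<open>ys\<close> that ends at place \<open>l\<close>. Applied to the zero vector,
        \<open>reduce\<close> completes it by coefficients on \<open>gs\<close> to a syzygy with
        leading entry \<open>x\<close>.\<close>
      define e where "e = (\<lambda>i. if i < l then - c i else if i = l then x else 0)"
      have "(\<Sum>i<length ys. e i * ys ! i) = (\<Sum>i<Suc l. e i * ys ! i)"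
        using l by (intro sum.mono_neutral_right) (auto simp: e_def)
      also have "\<dots> = (\<Sum>i<l. - (c i * ys ! i)) + x * ys ! l"
        by (simp add: e_def)
      finally have "(\<Sum>i<length ys. e i * ys ! i) = 0" by (simp add: eq sum_negf)
      moreover have e: "\<forall>i. e i \<in> A" using c x by (auto simp: e_def zero_mem uminus_mem)
      ultimately obtain a where a: "\<forall>q. a q \<in> A" "(\<lambda>_. 0) = comb (gs @ vs) a"
          "\<And>i. a (length gs + i) = e i"
        using reduce[of "\<lambda>_. 0" e] N unfolding graded_submodule_def by auto
      have *: "a j = 0" if "j > p" for j
        using a(3)[of "j - length gs"] that l by (auto simp: e_def)
      have "a j = 0" if "j \<ge> length (gs @ vs)" for j
        using * p that by auto
      then have "a \<in> syz (gs @ vs)" using a by (auto simp: syz_def fun_eq_iff)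
      moreover have "x = a p" using a(3)[of l] l by (simp add: e_def)
      ultimately show "x \<in> lead (syz (gs @ vs)) p" using * by (auto simp: lead_def)
    qed
    with F_colon[OF ys l(2)] show ?thesis by metis
  qed
  moreover have "{a \<in> N. \<forall>j\<ge>Suc k. a j = 0} \<subseteq> vspan (gs @ vs)"
  proof
    fix a assume a: "a \<in> {a \<in> N. \<forall>j\<ge>Suc k. a j = 0}"
    then have "a k \<in> ideal_span ys" unfolding lead_ys[symmetric] lead_def by auto
    then obtain e where "\<forall>l. e l \<in> A" "a k = (\<Sum>l<length ys. e l * ys ! l)"
      unfolding ideal_span_def by auto
    with reduce[of a e] a show "a \<in> vspan (gs @ vs)" by (auto simp: vspan_def)
  qed
  moreover have "g \<in> N \<and> (\<forall>j. g j \<in> H 1) \<and> (\<forall>j\<ge>Suc k. g j = 0)" if "g \<in> set (gs @ vs)" for g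
  proof (cases "g \<in> set gs")
    case True
    with gs show ?thesis by simp
  next
    case False
    with that obtain l where "l < length ys" "g = v l" by (auto simp: vs_def)
    with v show ?thesis by simp
  qed
  ultimately show ?case by (intro exI[of _ "gs @ vs"] conjI ballI) simp_all
qed

lemma linear_generators:
  assumes N: "graded_submodule N"
    and bound: "\<And>a j. a \<in> N \<Longrightarrow> j \<ge> b \<Longrightarrow> a j = 0"
    and lead: "\<And>k. k < b \<Longrightarrow> \<exists>ys\<in>F. lead N k = ideal_span ys"
  obtains gs where "\<And>g j. g \<in> set gs \<Longrightarrow> g j \<in> H 1" "vspan gs = N"
    "\<And>p. p < length gs \<Longrightarrow> \<exists>ys\<in>F. lead (syz gs) p = ideal_span ys"
proof -
  obtain gs where gs: "\<forall>g\<in>set gs. g \<in> N \<and> (\<forall>j. g j \<in> H 1) \<and> (\<forall>j\<ge>b. g j = 0)"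
    "{a \<in> N. \<forall>j\<ge>b. a j = 0} \<subseteq> vspan gs"
    "\<forall>p<length gs. \<exists>ys\<in>F. lead (syz gs) p = ideal_span ys"
    using generators_up_to[OF N lead order.refl] by blast
  moreover have "vspan gs \<subseteq> N"
    using comb_mem[OF N] gs(1) by (auto simp: vspan_def)
  moreover have "{a \<in> N. \<forall>j\<ge>b. a j = 0} = N" using bound by auto
  ultimately show ?thesis by (intro that[of gs]) simp_all
qed

text \<open>The invariant \<open>P\<close> asks for linear entries and for leading ideals of the
  syzygies that belong to the filtration. By \<open>linear_generators\<close> it passes from a list
  to generators of its syzygies. The start is the ideal itself inside a free module of rank 1, where
  it is its own leading ideal.\<close>

theorem linear_syzygies:
  assumes xs: "xs \<in> F"
  obtains gss where "vspan (gss 0) = {a. a 0 \<in> ideal_span xs \<and> (\<forall>j>0. a j = 0)}"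
    "\<And>i. vspan (gss (Suc i)) = syz (gss i)"
    "\<And>i g j. g \<in> set (gss i) \<Longrightarrow> g j \<in> H 1"
proof -
  define P where "P gs \<longleftrightarrow> (\<forall>g\<in>set gs. \<forall>j. g j \<in> H 1) \<and>
    (\<forall>p<length gs. \<exists>ys\<in>F. lead (syz gs) p = ideal_span ys)" for gs
  define N :: "(nat \<Rightarrow> 'r) set" where "N = {a. a 0 \<in> ideal_span xs \<and> (\<forall>j>0. a j = 0)}"
  have lin: "set xs \<subseteq> H 1" using F_linear xs by auto
  have "ideal_span xs \<subseteq> A" using lin H_subset by (intro ideal_span_subset) blast
  have cmp: "cmp 1 x \<in> ideal_span xs" if "x \<in> ideal_span xs" for x
  proof -
    from that obtain d where d: "\<forall>k. d k \<in> A" "x = (\<Sum>k<length xs. d k * xs ! k)"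
      unfolding ideal_span_def by blast
    have "cmp (Suc 0) x = (\<Sum>k<length xs. cmp 0 (d k) * xs ! k)"
      unfolding d cmp_sum using d lin by (intro sum.cong cmp_mult) auto
    moreover have "cmp 0 (d k) \<in> A" for k using d cmp_mem H_subset by fast
    ultimately show ?thesis
      unfolding ideal_span_def by (intro CollectI exI[of _ "\<lambda>k. cmp 0 (d k)"]) simp
  qed
  have "graded_submodule N"
    unfolding graded_submodule_def
  proof (intro conjI ballI allI)
    show "a j \<in> A" if "a \<in> N" for a j
      using that \<open>ideal_span xs \<subseteq> A\<close> zero_mem by (cases "j = 0") (auto simp: N_def)
    show "(\<lambda>_. 0) \<in> N" using zero_mem_ideal_span by (simp add: N_def)
    show "(\<lambda>j. a j + a' j) \<in> N" if "a \<in> N" "a' \<in> N" for a a'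
      using that by (simp add: N_def ideal_span_add)
    show "(\<lambda>j. c * a j) \<in> N" if "c \<in> A" "a \<in> N" for c a
      using that by (simp add: N_def ideal_span_mult)
    show "(\<lambda>j. cmp 1 (a j)) \<in> N" if "a \<in> N" for a
      using that cmp[of "a 0"] cmp_zero[of 1] by (simp add: N_def)
  qed
  moreover have "\<exists>ys\<in>F. lead N k = ideal_span ys" if "k < 1" for k
  proof -
    have "x \<in> lead N 0" if "x \<in> ideal_span xs" for x
      using that unfolding lead_def N_def by (intro CollectI exI[of _ "\<lambda>j. if j = 0 then x else 0"]) auto
    then have "lead N 0 = ideal_span xs" by (auto simp: lead_def N_def)
    with that xs show ?thesis by auto
  qed
  moreover have "a j = 0" if "a \<in> N" "j \<ge> 1" for a j
    using that by (auto simp: N_def)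
  ultimately obtain gs0 where gs0: "P gs0" "vspan gs0 = N"
    unfolding P_def using linear_generators[of N 1] by metis
  have step: "\<exists>hs. P hs \<and> vspan hs = syz gs" if "P gs" for gs
  proof -
    have "graded_submodule (syz gs)" using that by (intro syz_graded_submodule) (auto simp: P_def)
    moreover have "a j = 0" if "a \<in> syz gs" "j \<ge> length gs" for a j
      using that by (auto simp: syz_def)
    moreover have "\<exists>ys\<in>F. lead (syz gs) p = ideal_span ys" if "p < length gs" for p
      using that \<open>P gs\<close> by (auto simp: P_def)
    ultimately show ?thesis
      unfolding P_def using linear_generators[of "syz gs" "length gs"] by metis
  qed
  have "\<exists>gss. \<forall>i. (P (gss i) \<and> (i = 0 \<longrightarrow> gss i = gs0)) \<and> vspan (gss (Suc i)) = syz (gss i)"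
    using gs0 step by (intro dependent_nat_choice) auto
  then obtain gss where gss: "\<And>i. P (gss i)" "gss 0 = gs0" "\<And>i. vspan (gss (Suc i)) = syz (gss i)"
    by blast
  show ?thesis
    using gs0 gss by (intro that[of gss]) (auto simp: N_def P_def)
qed

end

section \<open>Semigroup algebras graded by the second coordinate\<close>

definition supported :: "'a set \<Rightarrow> ('a \<Rightarrow>\<^sub>0 'k::zero) set" where
  "supported S = {p. keys p \<subseteq> S}"

definition homogeneous :: "('a \<times> nat) set \<Rightarrow> nat \<Rightarrow> ('a \<times> nat \<Rightarrow>\<^sub>0 'k::zero) set" where
  "homogeneous S t = {p. keys p \<subseteq> S \<and> (\<forall>s\<in>keys p. snd s = t)}"

definition component :: "nat \<Rightarrow> ('a \<times> nat \<Rightarrow>\<^sub>0 'k) \<Rightarrow> ('a \<times> nat \<Rightarrow>\<^sub>0 'k::zero)" where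
  "component t p = Poly_Mapping.mapp (\<lambda>s c. if snd s = t then c else 0) p"

lemma lookup_component: "lookup (component t p) s = (if snd s = t then lookup p s else 0)"
  unfolding component_def by (auto simp: lookup_mapp when_def in_keys_iff)

lemma keys_component: "keys (component t p) = {s \<in> keys p. snd s = t}"
  by (auto simp: in_keys_iff lookup_component split: if_splits)

lemma component_add:
  fixes p q :: "'a \<times> nat \<Rightarrow>\<^sub>0 'k::monoid_add"
  shows "component t (p + q) = component t p + component t q"
  by (rule poly_mapping_eqI) (simp add: lookup_component lookup_add)

lemma component_single:
  "component t (single s c) = (if snd s = t then single s c else 0)"
  by (rule poly_mapping_eqI) (auto simp: lookup_component lookup_single when_def)

lemma component_zero [simp]: "component t 0 = 0"
  by (rule poly_mapping_eqI) (simp add: lookup_component)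

lemma component_sum: 
  fixes f :: "'b \<Rightarrow> ('a \<times> nat \<Rightarrow>\<^sub>0 'k::comm_monoid_add)"
  shows "component t (sum f X) = (\<Sum>x\<in>X. component t (f x))"
  by (induction X rule: infinite_finite_induct) (auto simp: component_add)

lemma component_mult:
  fixes p q :: "'a::comm_monoid_add \<times> nat \<Rightarrow>\<^sub>0 'k::comm_ring_1"
  assumes "\<forall>s\<in>keys q. snd s = u"
  shows "component (t + u) (p * q) = component t p * q"
proof (induction p rule: poly_mapping_single_induct)
  case (add s c p)
  have q: "q = (\<Sum>s'\<in>keys q. single s' (lookup q s'))" by (rule poly_mapping_sum_single)
  have "single s c * q = (\<Sum>s'\<in>keys q. single (s + s') (c * lookup q s'))"
    by (subst (1) q) (simp add: sum_distrib_left mult_single)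
  moreover have "component (t + u) \<dots> = (if snd s = t then \<dots> else 0)"
    using assms by (auto simp: component_sum component_single intro: sum.cong sum.neutral)
  ultimately have "component (t + u) (single s c * q) = component t (single s c) * q"
    by (simp add: component_single)
  then show ?case using add by (simp add: distrib_right component_add)
qed simp

lemma graded_subring_supported:
  fixes S :: "('a::comm_monoid_add \<times> nat) set"
  assumes zero: "0 \<in> S" and add: "\<And>s t. s \<in> S \<Longrightarrow> t \<in> S \<Longrightarrow> s + t \<in> S"
  shows "graded_subring (supported S :: (_ \<Rightarrow>\<^sub>0 'k::comm_ring_1) set) (homogeneous S) component"
proof
  fix x y :: "'a \<times> nat \<Rightarrow>\<^sub>0 'k" and s t
  show "1 \<in> (homogeneous S 0 :: ('a \<times> nat \<Rightarrow>\<^sub>0 'k) set)" using zero by (simp add: homogeneous_def)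
  show "- x \<in> supported S" if "x \<in> supported S"
    using that by (auto simp: supported_def in_keys_iff)
  show "x + y \<in> supported S" if "x \<in> supported S" "y \<in> supported S"
    using that keys_add[of x y] by (auto simp: supported_def)
  show "x * y \<in> supported S" if "x \<in> supported S" "y \<in> supported S"
    using that keys_mult[of x y] add by (fastforce simp: supported_def)
  show "homogeneous S t \<subseteq> (supported S :: ('a \<times> nat \<Rightarrow>\<^sub>0 'k) set)"
    by (auto simp: homogeneous_def supported_def)
  show "0 \<in> (homogeneous S t :: ('a \<times> nat \<Rightarrow>\<^sub>0 'k) set)" by (simp add: homogeneous_def)
  show "x + y \<in> homogeneous S t" if "x \<in> homogeneous S t" "y \<in> homogeneous S t"
    using that keys_add[of x y] by (auto simp: homogeneous_def)
  show "x * y \<in> homogeneous S (s + t)" if "x \<in> homogeneous S s" "y \<in> homogeneous S t"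
  proof -
    have "a \<in> S \<and> snd a = s + t" if "a \<in> keys (x * y)" for a
    proof -
      from that keys_mult obtain b c where "a = b + c" "b \<in> keys x" "c \<in> keys y" by blast
      with \<open>x \<in> _\<close> \<open>y \<in> _\<close> show ?thesis by (auto simp: homogeneous_def intro: add)
    qed
    then show ?thesis by (auto simp: homogeneous_def)
  qed
  show "component t x \<in> homogeneous S t" if "x \<in> supported S"
    using that by (auto simp: homogeneous_def supported_def keys_component)
  show "component t x = x" if "x \<in> homogeneous S t"
    using that by (intro poly_mapping_eqI) (auto simp: homogeneous_def lookup_component in_keys_iff)
  show "component t (x + y) = component t x + component t y" by (rule component_add)
  show "component (Suc t) (x * y) = component t x * y" if "y \<in> homogeneous S 1"
    using component_mult[of y 1 t x] that by (simp add: homogeneous_def)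
qed

text \<open>The semigroup generated by the pairs \<open>(e, 1)\<close> with \<open>e\<close> in
  \<open>E\<close>. A multiset behind a pair is a factorization of the corresponding monomial into
  variables.\<close>

definition sumsets :: "nat set \<Rightarrow> (nat \<times> nat) set" where
  "sumsets E = {(sum_mset w, size w) |w. set_mset w \<subseteq> E}"

lemma zero_sumsets: "0 \<in> sumsets E"
  unfolding sumsets_def by (intro CollectI exI[of _ "{#}"]) (simp add: zero_prod_def)

lemma add_sumsets: "s \<in> sumsets E \<Longrightarrow> t \<in> sumsets E \<Longrightarrow> s + t \<in> sumsets E"
proof -
  assume "s \<in> sumsets E" "t \<in> sumsets E"
  then obtain v w where "set_mset v \<subseteq> E" "set_mset w \<subseteq> E"
    "s = (sum_mset v, size v)" "t = (sum_mset w, size w)"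
    unfolding sumsets_def by blast
  then show ?thesis
    unfolding sumsets_def by (intro CollectI exI[of _ "v + w"]) auto
qed

section \<open>The curve algebra as a semigroup algebra\<close>

text \<open>If \<open>f\<close> gives the exponent of \<open>u\<close> in the image of each
  variable, this is the exponent of \<open>u\<close> in the image of the monomial \<open>s\<close>,
  together with the degree of \<open>s\<close>. The degree replaces the exponent of
  \<open>v\<close>, because it is the grading.\<close>

definition bidegree :: "(nat \<Rightarrow> nat) \<Rightarrow> (nat \<Rightarrow>\<^sub>0 nat) \<Rightarrow> nat \<times> nat" where
  "bidegree f s = (extend_lin f s, extend_lin (\<lambda>_. 1) s)"

lemma bidegree_add: "bidegree f (s + t) = bidegree f s + bidegree f t"
  by (simp add: bidegree_def)

lemma bidegree_zero [simp]: "bidegree f 0 = 0"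
  by (simp add: bidegree_def zero_prod_def)

lemma snd_bidegree: "snd (bidegree f s) = mon_degree s"
  by (simp add: bidegree_def mon_degree_def extend_lin_def)

lemma bidegree_image: "bidegree f ` {s. keys s \<subseteq> V} = sumsets (f ` V)"
proof (intro equalityI subsetI)
  fix x assume "x \<in> bidegree f ` {s. keys s \<subseteq> V}"
  then obtain s where s: "keys s \<subseteq> V" and x: "x = bidegree f s" by auto
  have "bidegree f (single i k) \<in> sumsets (f ` V)" if "i \<in> V" for i k
    using that unfolding sumsets_def bidegree_def
    by (intro CollectI exI[of _ "replicate_mset k (f i)"]) (auto split: if_splits)
  note * = this
  have "bidegree f s \<in> sumsets (f ` V)"
    by (induction s rule: poly_mapping_single_induct)
       (use s in \<open>auto simp: zero_sumsets bidegree_add intro!: add_sumsets *\<close>)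
  then show "x \<in> sumsets (f ` V)" by (simp add: x)
next
  fix x assume "x \<in> sumsets (f ` V)"
  then obtain w where w: "set_mset w \<subseteq> f ` V" and x: "x = (sum_mset w, size w)"
    by (auto simp: sumsets_def)
  from w have "\<exists>s. keys s \<subseteq> V \<and> bidegree f s = (sum_mset w, size w)"
  proof (induction w)
    case empty
    then show ?case by (intro exI[of _ 0]) (simp add: zero_prod_def)
  next
    case (add e w)
    then obtain s i where "keys s \<subseteq> V" "bidegree f s = (sum_mset w, size w)" "i \<in> V" "e = f i"
      by auto
    then show ?case
      using keys_add[of "single i 1" s]
      by (intro exI[of _ "single i 1 + s"]) (auto simp: bidegree_add bidegree_def split: if_splits)
  qed
  then show "x \<in> bidegree f ` {s. keys s \<subseteq> V}" unfolding x by force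
qed

text \<open>The last variable is sent to a power of \<open>v\<close> alone and gets weight 0; it is
  the source of the element 0 of \<open>E\<close>.\<close>

definition weight :: "nat \<Rightarrow> (nat \<Rightarrow> nat) \<Rightarrow> nat \<Rightarrow> nat" where
  "weight n m i = (if i \<in> {1..n} then m i else 0)"

lemma prod_power_single:
  fixes g :: "'b \<Rightarrow> 'a \<Rightarrow>\<^sub>0 nat"
  shows "(\<Prod>i\<in>I. single (g i) (1::'k::comm_ring_1) ^ e i) = single (\<Sum>i\<in>I. \<Sum>j<e i. g i) 1"
proof -
  have "single (g i) (1::'k) ^ k = single (\<Sum>j<k. g i) 1" for i k
    by (induction k) (auto simp: mult_single add.commute)
  then show ?thesis
    by (induction I rule: infinite_finite_induct) (auto simp: mult_single)
qed

lemma sum_single: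
  "(\<Sum>x\<in>X. single i (f x)) = single i (\<Sum>x\<in>X. f x :: nat)"
  by (induction X rule: infinite_finite_induct) (auto simp: single_add)

lemma single_power:
  "single (single i (Suc 0)) (1::'k::comm_ring_1) ^ k = single (single i (k::nat)) 1"
  by (induction k) (simp_all add: mult_single flip: single_add)

lemma sum_two_singles:
  "(\<Sum>j<k. single i a + single i' b) = single i (k * a) + single i' (k * b :: nat)"
  by (simp only: sum.distrib sum_single) simp

context
  fixes n :: nat and m :: "nat \<Rightarrow> nat"
begin

text \<open>The subtraction is not truncated at the bidegrees of monomials in the variables of the curve.\<close>

definition uv_monomial :: "nat \<times> nat \<Rightarrow> nat \<Rightarrow>\<^sub>0 nat" where
  "uv_monomial x = single 0 (fst x) + single 1 (snd x * m n - fst x)"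

lemma curve_param_eq:
  "curve_param n m i = (single (single 0 (weight n m i) + single 1 (m n - weight n m i)) 1 :: 'k::comm_ring_1 mpol)"
  by (auto simp: curve_param_def weight_def Var_def single_power mult_single)

lemma poly_subst_curve_param:
  fixes p :: "'k::comm_ring_1 mpol"
  assumes le: "\<forall>i\<in>{1..n}. m i \<le> m n"
  shows "poly_subst (curve_param n m) p = push (uv_monomial \<circ> bidegree (weight n m)) p"
proof -
  have "(\<Prod>i\<in>keys s. curve_param n m i ^ lookup s i) =
      (single (uv_monomial (bidegree (weight n m) s)) 1 :: 'k mpol)" for s
  proof -
    \<comment> \<open>The subtractions must be pulled out of the sum; they are exact since every
      weight is at most \<open>m n\<close>.\<close>
    have "(\<Sum>i\<in>keys s. lookup s i * (m n - weight n m i)) + (\<Sum>i\<in>keys s. lookup s i * weight n m i)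
        = (\<Sum>i\<in>keys s. lookup s i) * m n"
      unfolding sum.distrib[symmetric] sum_distrib_right
    proof (intro sum.cong refl)
      fix i
      have "weight n m i \<le> m n" using le by (simp add: weight_def)
      then show "lookup s i * (m n - weight n m i) + lookup s i * weight n m i = lookup s i * m n"
        by (simp flip: distrib_left)
    qed
    then have "(\<Sum>i\<in>keys s. lookup s i * (m n - weight n m i)) =
        (\<Sum>i\<in>keys s. lookup s i) * m n - (\<Sum>i\<in>keys s. lookup s i * weight n m i)"
      by linarith
    then show ?thesis
      unfolding curve_param_eq prod_power_single sum_two_singles
      by (simp add: uv_monomial_def bidegree_def extend_lin_def sum.distrib sum_single)
  qed
  then show ?thesis
    unfolding poly_subst_def push_def by (simp add: Const_def mult_single)
qed

text \<open>The exponents of \<open>u\<close> and \<open>v\<close> add up to \<open>m n\<close>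
  times the degree, and \<open>m n\<close> is positive, so the degree can be recovered.\<close>

lemma inj_on_uv_monomial:
  assumes le: "\<forall>i\<in>{1..n}. m i \<le> m n" and pos: "m n > 0"
  shows "inj_on uv_monomial (range (bidegree (weight n m)))"
proof (rule inj_onI)
  have bound: "fst x \<le> snd x * m n" if x: "x \<in> range (bidegree (weight n m))" for x
  proof -
    obtain s where "x = bidegree (weight n m) s" using x by auto
    moreover have "weight n m i \<le> m n" for i using le by (simp add: weight_def)
    ultimately show ?thesis
      by (auto simp: bidegree_def extend_lin_def sum_distrib_right intro!: sum_mono)
  qed
  fix x y assume x: "x \<in> range (bidegree (weight n m))" and y: "y \<in> range (bidegree (weight n m))"
    and eq: "uv_monomial x = uv_monomial y"
  have "lookup (uv_monomial x) i = lookup (uv_monomial y) i" for i by (simp add: eq)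
  from this[of 0] this[of 1] have "fst x = fst y" "snd x * m n - fst x = snd y * m n - fst y"
    by (simp_all add: uv_monomial_def lookup_add lookup_single)
  with bound[OF x] bound[OF y] have "snd x * m n = snd y * m n" by linarith
  with pos have "snd x = snd y" by simp
  with \<open>fst x = fst y\<close> show "x = y" by (simp add: prod_eq_iff)
qed

end

text \<open>A record on the whole type, so that the homomorphism theorem for ring records applies;
  the image of the polynomial ring in it is then described by \<open>supported\<close>.\<close>

definition semigroup_ring :: "('a::comm_monoid_add \<Rightarrow>\<^sub>0 'k::comm_ring_1) ring" where
  "semigroup_ring = \<lparr>carrier = UNIV, monoid.mult = (*), one = 1, zero = 0, add = (+)\<rparr>"

lemma semigroup_ring_simps [simp]:
  "\<zero>\<^bsub>semigroup_ring\<^esub> = 0" "\<one>\<^bsub>semigroup_ring\<^esub> = 1" "x \<oplus>\<^bsub>semigroup_ring\<^esub> y = x + y"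
  "x \<otimes>\<^bsub>semigroup_ring\<^esub> y = x * y" "carrier semigroup_ring = UNIV"
  by (auto simp: semigroup_ring_def)

lemma cring_semigroup_ring: "cring (semigroup_ring :: ('a::comm_monoid_add \<Rightarrow>\<^sub>0 'k::comm_ring_1) ring)"
proof (rule cringI)
  show "abelian_group (semigroup_ring :: ('a \<Rightarrow>\<^sub>0 'k) ring)"
  proof (rule abelian_groupI)
    fix x :: "'a \<Rightarrow>\<^sub>0 'k"
    show "\<exists>y\<in>carrier semigroup_ring. y \<oplus>\<^bsub>semigroup_ring\<^esub> x = \<zero>\<^bsub>semigroup_ring\<^esub>"
      by (intro bexI[of _ "- x"]) simp_all
  qed (simp_all add: add.assoc add.commute)
  show "comm_monoid (semigroup_ring :: ('a \<Rightarrow>\<^sub>0 'k) ring)"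
    by (rule comm_monoidI) (simp_all add: mult.assoc mult.commute)
qed (simp add: distrib_right)

lemma poly_ring_carrier_closed:
  fixes p q :: "'k::comm_ring_1 mpol"
  assumes "p \<in> carrier (poly_ring V)" "q \<in> carrier (poly_ring V)"
  shows "p + q \<in> carrier (poly_ring V)" "p * q \<in> carrier (poly_ring V)" "- p \<in> carrier (poly_ring V)"
proof -
  have "keys s \<subseteq> V" if "s \<in> keys (p + q)" for s
    using assms subsetD[OF keys_add that] unfolding poly_ring_def by auto
  then show "p + q \<in> carrier (poly_ring V)" by (simp add: poly_ring_def)
  have "keys s \<subseteq> V" if "s \<in> keys (p * q)" for s
  proof -
    from subsetD[OF keys_mult that] obtain a b where "s = a + b" "a \<in> keys p" "b \<in> keys q" by blast
    with assms have "keys a \<union> keys b \<subseteq> V" by (simp add: poly_ring_def)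
    then show ?thesis unfolding \<open>s = a + b\<close> using keys_add[of a b] by (rule order.trans[rotated])
  qed
  then show "p * q \<in> carrier (poly_ring V)" by (simp add: poly_ring_def)
  show "- p \<in> carrier (poly_ring V)" using assms by (simp add: poly_ring_def in_keys_iff)
qed

lemma poly_ring_simps [simp]:
  "\<zero>\<^bsub>poly_ring V\<^esub> = 0" "\<one>\<^bsub>poly_ring V\<^esub> = 1" "x \<oplus>\<^bsub>poly_ring V\<^esub> y = x + y" "x \<otimes>\<^bsub>poly_ring V\<^esub> y = x * y"
  "0 \<in> carrier (poly_ring V)" "1 \<in> carrier (poly_ring V)"
  by (auto simp: poly_ring_def)

lemma cring_poly_ring: "cring (poly_ring V :: 'k::comm_ring_1 mpol ring)"
proof (rule cringI)
  show "abelian_group (poly_ring V :: 'k mpol ring)"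
  proof (rule abelian_groupI)
    fix x :: "'k mpol" assume "x \<in> carrier (poly_ring V)"
    then show "\<exists>y\<in>carrier (poly_ring V). y \<oplus>\<^bsub>poly_ring V\<^esub> x = \<zero>\<^bsub>poly_ring V\<^esub>"
      by (intro bexI[of _ "- x"] poly_ring_carrier_closed) simp_all
  qed (simp_all add: poly_ring_carrier_closed add.assoc add.commute)
  show "comm_monoid (poly_ring V :: 'k mpol ring)"
    by (rule comm_monoidI) (simp_all add: poly_ring_carrier_closed mult.assoc mult.commute)
qed (simp add: distrib_right)


lemma a_kernel_cong:
  assumes "\<And>x. x \<in> carrier R \<Longrightarrow> f x = \<zero>\<^bsub>S\<^esub> \<longleftrightarrow> g x = \<zero>\<^bsub>T\<^esub>"
  shows "a_kernel R S f = a_kernel R T g"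
  using assms by (auto simp: a_kernel_def kernel_def)

text \<open>The map induced on cosets: \<open>push\<close> is constant on a coset of its kernel, and
  \<open>the_elem\<close> extracts the common value.\<close>

definition curve_iso :: "nat \<Rightarrow> (nat \<Rightarrow> nat) \<Rightarrow> 'k::comm_ring_1 mpol set \<Rightarrow> nat \<times> nat \<Rightarrow>\<^sub>0 'k" where
  "curve_iso n m X = the_elem (push (bidegree (weight n m)) ` X)"

lemma ring_hom_push_bidegree:
  "ring_hom_ring (poly_ring V) (semigroup_ring :: (nat \<times> nat \<Rightarrow>\<^sub>0 'k::comm_ring_1) ring) (push (bidegree f))"
  by (rule ring_hom_ringI)
    (simp_all add: cring.axioms(1) cring_poly_ring cring_semigroup_ring push_mult bidegree_add
      flip: single_one)

lemma push_bidegree_image: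
  "push (bidegree f) ` carrier (poly_ring V) =
    (supported (sumsets (f ` V)) :: (_ \<Rightarrow>\<^sub>0 'k::comm_ring_1) set)" (is ?A)
  "push (bidegree f) ` poly_grading V t =
    (homogeneous (sumsets (f ` V)) t :: (_ \<Rightarrow>\<^sub>0 'k::comm_ring_1) set)" (is ?B)
proof -
  \<comment> \<open>A section of \<open>bidegree\<close>. Pushing along it lifts elements of the
    semigroup algebra to polynomials, and it respects degrees because the degree is part of the
    bidegree.\<close>
  define r where "r = inv_into {s. keys s \<subseteq> V} (bidegree f)"
  have r: "keys (r x) \<subseteq> V" "bidegree f (r x) = x" if "x \<in> sumsets (f ` V)" for x
    using that inv_into_into[of x "bidegree f" "{s. keys s \<subseteq> V}"]
      f_inv_into_f[of x "bidegree f" "{s. keys s \<subseteq> V}"]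
    by (simp_all add: r_def bidegree_image)
  have carr: "keys (push (bidegree f) p) \<subseteq> sumsets (f ` V)" if "p \<in> carrier (poly_ring V)"
    for p :: "'k mpol"
    unfolding bidegree_image[symmetric] using keys_push[of "bidegree f" p] that
    by (auto simp: poly_ring_def)
  have lift: "push r q \<in> carrier (poly_ring V)" "push (bidegree f) (push r q) = q"
    if "keys q \<subseteq> sumsets (f ` V)" for q :: "_ \<Rightarrow>\<^sub>0 'k"
  proof -
    have "keys s \<subseteq> V" if "s \<in> keys (push r q)" for s
    proof -
      from subsetD[OF keys_push that] obtain x where "x \<in> keys q" "s = r x" by (rule imageE)
      with r(1) \<open>keys q \<subseteq> _\<close> show ?thesis by blast
    qed
    then show "push r q \<in> carrier (poly_ring V)" by (simp add: poly_ring_def)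
    have "push (bidegree f \<circ> r) q = push (\<lambda>x. x) q" using that r by (intro push_cong) auto
    then show "push (bidegree f) (push r q) = q" by (simp add: push_comp)
  qed
  show ?A
  proof (intro equalityI subsetI)
    fix q :: "_ \<Rightarrow>\<^sub>0 'k" assume "q \<in> supported (sumsets (f ` V))"
    then show "q \<in> push (bidegree f) ` carrier (poly_ring V)"
      using lift[of q] by (intro image_eqI[of _ _ "push r q"]) (auto simp: supported_def)
  qed (use carr in \<open>auto simp: supported_def\<close>)
  show ?B
  proof (intro equalityI subsetI)
    fix q :: "_ \<Rightarrow>\<^sub>0 'k" assume q: "q \<in> homogeneous (sumsets (f ` V)) t"
    have "mon_degree s = t" if "s \<in> keys (push r q)" for s
    proof -
      from subsetD[OF keys_push that] obtain x where "x \<in> keys q" "s = r x" by (rule imageE)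
      with r(2)[of x] q show ?thesis
        unfolding snd_bidegree[of f, symmetric] homogeneous_def by auto
    qed
    then show "q \<in> push (bidegree f) ` poly_grading V t"
      using lift[of q] q
      by (intro image_eqI[of _ _ "push r q"]) (auto simp: homogeneous_def poly_grading_def)
  next
    fix q :: "_ \<Rightarrow>\<^sub>0 'k" assume "q \<in> push (bidegree f) ` poly_grading V t"
    then obtain p where p: "p \<in> poly_grading V t" "q = push (bidegree f) p" by auto
    then have "\<forall>s\<in>keys q. snd s = t"
      using keys_push[of "bidegree f" p] by (auto simp: poly_grading_def snd_bidegree)
    with p carr show "q \<in> homogeneous (sumsets (f ` V)) t"
      by (auto simp: homogeneous_def poly_grading_def)
  qed
qed

text \<open>The parametrization is \<open>push\<close> along the bidegree followed by
  \<open>push\<close> along \<open>uv_monomial\<close>, which is injective on bidegrees. Hence the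
  vanishing ideal is the kernel of the first map alone, and the homomorphism theorem identifies the
  quotient with its image.\<close>

lemma curve_iso:
  fixes n :: nat and m :: "nat \<Rightarrow> nat"
  assumes le: "\<forall>i\<in>{1..n}. m i \<le> m n" and pos: "m n > 0"
  defines "A \<equiv> curve_algebra n m :: 'k::comm_ring_1 mpol set ring"
    and "\<phi> \<equiv> curve_iso n m :: 'k mpol set \<Rightarrow> _"
    and "S \<equiv> sumsets (insert 0 (m ` {1..n}))"
  shows "cring A" "bij_betw \<phi> (carrier A) (supported S)"
    "\<phi> \<one>\<^bsub>A\<^esub> = 1"
    "\<And>x y. x \<in> carrier A \<Longrightarrow> y \<in> carrier A \<Longrightarrow> \<phi> (x \<oplus>\<^bsub>A\<^esub> y) = \<phi> x + \<phi> y"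
    "\<And>x y. x \<in> carrier A \<Longrightarrow> y \<in> carrier A \<Longrightarrow> \<phi> (x \<otimes>\<^bsub>A\<^esub> y) = \<phi> x * \<phi> y"
    "\<And>t. curve_grading n m t \<subseteq> carrier A" "\<And>t. \<phi> ` curve_grading n m t = homogeneous S t"
proof -
  let ?R = "poly_ring {1..n + 1} :: 'k mpol ring"
  let ?h = "push (bidegree (weight n m)) :: 'k mpol \<Rightarrow> _"
  interpret h: ring_hom_ring ?R semigroup_ring ?h by (rule ring_hom_push_bidegree)
  have W: "weight n m ` {1..n + 1} = insert 0 (m ` {1..n})"
    by (force simp: weight_def)
  have ker: "curve_ideal n m = a_kernel ?R semigroup_ring ?h"
    unfolding curve_ideal_def
  proof (rule a_kernel_cong)
    fix p :: "'k mpol"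
    have "push (uv_monomial n m) (?h p) = 0 \<longleftrightarrow> ?h p = 0"
      by (rule push_eq_0_iff, rule inj_on_subset, rule inj_on_uv_monomial[OF le pos])
        (use keys_push[of "bidegree (weight n m)" p] in auto)
    then show "poly_subst (curve_param n m) p = \<zero>\<^bsub>poly_ring {0, 1}\<^esub> \<longleftrightarrow> ?h p = \<zero>\<^bsub>semigroup_ring\<^esub>"
      by (simp add: poly_subst_curve_param[OF le] push_comp)
  qed
  have A: "A = ?R Quot a_kernel ?R semigroup_ring ?h"
    unfolding A_def curve_algebra_def ker ..
  have \<phi>: "\<phi> = (\<lambda>X. the_elem (?h ` X))"
    unfolding \<phi>_def curve_iso_def ..
  have \<phi>_coset: "\<phi> (a_kernel ?R semigroup_ring ?h +>\<^bsub>?R\<^esub> p) = ?h p" if "p \<in> carrier ?R" for p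
    unfolding \<phi> by (rule h.the_elem_simp[OF that])
  have coset_mem: "a_kernel ?R semigroup_ring ?h +>\<^bsub>?R\<^esub> p \<in> carrier A" if "p \<in> carrier ?R" for p
    unfolding A FactRing_def using that by (auto simp: A_RCOSETS_def')
  show "cring A"
    unfolding A by (rule ideal.quotient_is_cring[OF h.kernel_is_ideal cring_poly_ring])
  have hom: "\<phi> \<in> ring_hom A semigroup_ring"
    unfolding \<phi> A by (rule h.the_elem_hom)
  show "\<phi> \<one>\<^bsub>A\<^esub> = 1" using ring_hom_one[OF hom] by simp
  show "\<phi> (x \<oplus>\<^bsub>A\<^esub> y) = \<phi> x + \<phi> y" "\<phi> (x \<otimes>\<^bsub>A\<^esub> y) = \<phi> x * \<phi> y"
    if "x \<in> carrier A" "y \<in> carrier A" for x y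
    using ring_hom_add[OF hom that] ring_hom_mult[OF hom that] by simp_all
  have "\<phi> ` carrier A = supported S"
    unfolding \<phi> A h.the_elem_surj push_bidegree_image W S_def ..
  moreover have "inj_on \<phi> (carrier A)"
    unfolding \<phi> A by (intro inj_onI h.the_elem_inj)
  ultimately show "bij_betw \<phi> (carrier A) (supported S)" by (simp add: bij_betw_def)
  have sub: "poly_grading {1..n + 1} t \<subseteq> carrier ?R" for t
    by (auto simp: poly_grading_def)
  show "curve_grading n m t \<subseteq> carrier A" for t
    unfolding curve_grading_def quot_grading_def ker using coset_mem sub by blast
  show "\<phi> ` curve_grading n m t = homogeneous S t" for t
  proof -
    have "\<phi> ` curve_grading n m t = ?h ` poly_grading {1..n + 1} t"
      unfolding curve_grading_def quot_grading_def ker image_image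
      by (intro image_cong refl \<phi>_coset) (use sub in auto)
    then show ?thesis unfolding push_bidegree_image W S_def .
  qed
qed

section \<open>Resolutions over rings presented by an isomorphism\<close>

text \<open>The bridge between the record \<open>R\<close>, over which Koszulness is defined, and
  the subring \<open>A\<close>. The list \<open>xs\<close> consists of linear generators of the
  irrelevant ideal; that 1 is not in their span makes the residue field nonzero.\<close>

locale graded_ring_iso = graded_subring A H cmp
  for A :: "'r::comm_ring_1 set" and H cmp +
  fixes R :: "'a ring" and G :: "nat \<Rightarrow> 'a set" and \<phi> :: "'a \<Rightarrow> 'r" and xs :: "'r list"
  assumes cring_R: "cring R"
    and bij: "bij_betw \<phi> (carrier R) A"
    and phi_one: "\<phi> \<one>\<^bsub>R\<^esub> = 1"
    and phi_add: "x \<in> carrier R \<Longrightarrow> y \<in> carrier R \<Longrightarrow> \<phi> (x \<oplus>\<^bsub>R\<^esub> y) = \<phi> x + \<phi> y"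
    and phi_mult: "x \<in> carrier R \<Longrightarrow> y \<in> carrier R \<Longrightarrow> \<phi> (x \<otimes>\<^bsub>R\<^esub> y) = \<phi> x * \<phi> y"
    and G_carrier: "G t \<subseteq> carrier R"
    and phi_G: "\<phi> ` G t = H t"
    and xs_linear: "set xs \<subseteq> H 1"
    and xs_generate: "t > 0 \<Longrightarrow> H t \<subseteq> ideal_span xs"
    and xs_proper: "1 \<notin> ideal_span xs"
begin

sublocale R: cring R by (rule cring_R)

definition \<psi> :: "'r \<Rightarrow> 'a" where
  "\<psi> = inv_into (carrier R) \<phi>"

lemma phi_mem: "x \<in> carrier R \<Longrightarrow> \<phi> x \<in> A"
  using bij by (auto simp: bij_betw_def)

lemma psi_mem: "x \<in> A \<Longrightarrow> \<psi> x \<in> carrier R"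
  unfolding \<psi>_def using bij inv_into_into[of x \<phi> "carrier R"] by (simp add: bij_betw_def)

lemma phi_psi: "x \<in> A \<Longrightarrow> \<phi> (\<psi> x) = x"
  unfolding \<psi>_def using bij by (simp add: bij_betw_inv_into_right)

lemma phi_inject: "x \<in> carrier R \<Longrightarrow> y \<in> carrier R \<Longrightarrow> \<phi> x = \<phi> y \<longleftrightarrow> x = y"
  using bij by (auto simp: bij_betw_def inj_on_def)

lemma psi_phi: "x \<in> carrier R \<Longrightarrow> \<psi> (\<phi> x) = x"
  using phi_inject[OF psi_mem[OF phi_mem], of x x] phi_psi[OF phi_mem, of x] by simp

lemma phi_zero: "\<phi> \<zero>\<^bsub>R\<^esub> = 0"
  using phi_add[of "\<zero>\<^bsub>R\<^esub>" "\<zero>\<^bsub>R\<^esub>"] by simp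

lemma psi_eq_iff: "x \<in> A \<Longrightarrow> y \<in> carrier R \<Longrightarrow> \<psi> x = y \<longleftrightarrow> x = \<phi> y"
  using phi_psi[of x] psi_phi[of y] by auto

lemma mem_G_iff: "x \<in> carrier R \<Longrightarrow> x \<in> G t \<longleftrightarrow> \<phi> x \<in> H t"
  unfolding phi_G[symmetric] using inj_on_image_mem_iff[OF bij_betw_imp_inj_on[OF bij] _ G_carrier, of x t]
  by simp

abbreviation I where "I \<equiv> irrelevant_ideal R G"

lemma ideal_I: "ideal I R"
  unfolding irrelevant_ideal_def using G_carrier by (intro R.genideal_ideal) auto

sublocale I: ideal I R by (rule ideal_I)

text \<open>The elements mapped into \<open>ideal_span xs\<close> form an ideal that contains all
  components of positive degree; conversely, the preimages of the generators \<open>xs\<close> have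
  degree 1.\<close>

lemma mem_I_iff:
  assumes x: "x \<in> carrier R"
  shows "x \<in> I \<longleftrightarrow> \<phi> x \<in> ideal_span xs"
proof
  let ?J = "{x \<in> carrier R. \<phi> x \<in> ideal_span xs}"
  note zero_mem_ideal_span
  moreover have "\<phi> (\<ominus>\<^bsub>R\<^esub> x) = (- 1) * \<phi> x" if "x \<in> carrier R" for x
    using that phi_add[of x "\<ominus>\<^bsub>R\<^esub> x"] phi_zero by (simp add: R.r_neg eq_neg_iff_add_eq_0 add.commute)
  ultimately have "subgroup ?J (add_monoid R)"
    using ideal_span_mult[of _ xs "- 1"]
    by (intro R.add.subgroupI)
      (auto simp: phi_add ideal_span_add one_mem uminus_mem phi_zero intro!: exI[of _ "\<zero>\<^bsub>R\<^esub>"])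
  then have "ideal ?J R"
  proof (intro idealI R.ring_axioms)
    fix y a assume *: "y \<in> ?J" "a \<in> carrier R"
    then have "\<phi> a * \<phi> y \<in> ideal_span xs" by (simp add: ideal_span_mult phi_mem)
    with * show "a \<otimes>\<^bsub>R\<^esub> y \<in> ?J" "y \<otimes>\<^bsub>R\<^esub> a \<in> ?J"
      by (simp_all add: phi_mult mult.commute[of "\<phi> y"])
  qed
  moreover have "(\<Union>t\<in>{0<..}. G t) \<subseteq> ?J"
  proof
    fix y assume "y \<in> (\<Union>t\<in>{0<..}. G t)"
    then obtain t where "t > 0" "y \<in> G t" by auto
    moreover from this have "y \<in> carrier R" using G_carrier by blast
    ultimately show "y \<in> ?J" using mem_G_iff[of y t] xs_generate[of t] by auto
  qed
  ultimately have "I \<subseteq> ?J"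
    unfolding irrelevant_ideal_def by (rule R.genideal_minimal)
  then show "\<phi> x \<in> ideal_span xs" if "x \<in> I" using that by auto
next
  assume "\<phi> x \<in> ideal_span xs"
  then obtain c where c: "\<forall>k. c k \<in> A" "\<phi> x = (\<Sum>k<length xs. c k * xs ! k)"
    by (auto simp: ideal_span_def)
  have xsA: "xs ! k \<in> A" "\<psi> (xs ! k) \<in> I" if "k < length xs" for k
  proof -
    have "xs ! k \<in> H 1" using that xs_linear by auto
    then show "xs ! k \<in> A" using H_subset by auto
    with \<open>xs ! k \<in> H 1\<close> have "\<psi> (xs ! k) \<in> G 1" by (simp add: mem_G_iff psi_mem phi_psi)
    then have "\<psi> (xs ! k) \<in> (\<Union>t\<in>{0<..}. G t)" by auto
    then show "\<psi> (xs ! k) \<in> I"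
      unfolding irrelevant_ideal_def using R.genideal_self[of "\<Union>t\<in>{0<..}. G t"] G_carrier by blast
  qed
  have "\<exists>y\<in>I. \<phi> y = (\<Sum>k<l. c k * xs ! k)" if "l \<le> length xs" for l
    using that
  proof (induction l)
    case 0
    then show ?case by (intro bexI[of _ "\<zero>\<^bsub>R\<^esub>"]) (auto simp: phi_zero)
  next
    case (Suc l)
    then obtain y where "y \<in> I" "\<phi> y = (\<Sum>k<l. c k * xs ! k)" by auto
    moreover have "\<psi> (c l) \<otimes>\<^bsub>R\<^esub> \<psi> (xs ! l) \<in> I"
      using Suc.prems c xsA[of l] by (intro I.I_l_closed) (auto simp: psi_mem)
    ultimately show ?case
      using Suc.prems c xsA[of l]
      by (intro bexI[of _ "y \<oplus>\<^bsub>R\<^esub> \<psi> (c l) \<otimes>\<^bsub>R\<^esub> \<psi> (xs ! l)"])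
        (simp_all add: phi_add phi_mult phi_psi psi_mem I.Icarr)
  qed
  from this[of "length xs"] c obtain y where "y \<in> I" "\<phi> y = \<phi> x" by auto
  then show "x \<in> I" using x phi_inject[of y x] I.Icarr[of y] by simp
qed

lemma coset_eq_I_iff: "x \<in> carrier R \<Longrightarrow> I +>\<^bsub>R\<^esub> x = I \<longleftrightarrow> x \<in> I"
  using I.a_rcos_const[of x] I.a_rcos_self[of x] by auto

text \<open>Entries from the rank on are \<open>undefined\<close> for elements of
  \<open>free_module\<close> but 0 for the functions used over \<open>A\<close>;
  \<open>tuple\<close> and \<open>untuple\<close> convert between the two conventions.\<close>

definition tuple :: "nat \<Rightarrow> (nat \<Rightarrow> 'r) \<Rightarrow> nat \<Rightarrow> 'a" where
  "tuple b a = (\<lambda>j\<in>{..<b}. \<psi> (a j))"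

definition untuple :: "nat \<Rightarrow> (nat \<Rightarrow> 'a) \<Rightarrow> nat \<Rightarrow> 'r" where
  "untuple b x k = (if k < b then \<phi> (x k) else 0)"

lemma free_module_entry: "x \<in> carrier (free_module R b) \<Longrightarrow> k < b \<Longrightarrow> x k \<in> carrier R"
  unfolding free_module_def by (auto dest: PiE_mem)

lemma tuple_mem: "(\<And>j. j < b \<Longrightarrow> a j \<in> A) \<Longrightarrow> tuple b a \<in> carrier (free_module R b)"
  by (auto simp: tuple_def free_module_def psi_mem)

lemma untuple_mem: "x \<in> carrier (free_module R b) \<Longrightarrow> untuple b x k \<in> A"
  by (simp add: untuple_def free_module_entry phi_mem zero_mem)

lemma untuple_tuple:
  "(\<And>j. j < b \<Longrightarrow> a j \<in> A) \<Longrightarrow> (\<And>j. j \<ge> b \<Longrightarrow> a j = 0) \<Longrightarrow> untuple b (tuple b a) = a"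
  by (auto simp: untuple_def tuple_def phi_psi fun_eq_iff)

lemma tuple_untuple: "x \<in> carrier (free_module R b) \<Longrightarrow> tuple b (untuple b x) = x"
  by (auto simp: untuple_def tuple_def free_module_def fun_eq_iff PiE_def extensional_def Pi_def psi_phi)

lemma untuple_add:
  "x \<in> carrier (free_module R b) \<Longrightarrow> y \<in> carrier (free_module R b) \<Longrightarrow>
    untuple b (x \<oplus>\<^bsub>free_module R b\<^esub> y) k = untuple b x k + untuple b y k"
  using free_module_entry[of x b k] free_module_entry[of y b k]
  by (simp add: untuple_def phi_add) (simp add: free_module_def phi_add)

lemma untuple_smult:
  "x \<in> carrier (free_module R b) \<Longrightarrow> a \<in> carrier R \<Longrightarrow>
    untuple b (a \<odot>\<^bsub>free_module R b\<^esub> x) k = \<phi> a * untuple b x k"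
  using free_module_entry[of x b k]
  by (simp add: untuple_def) (simp add: free_module_def phi_mult)

lemma tuple_add:
  "(\<And>j. j < b \<Longrightarrow> a j \<in> A) \<Longrightarrow> (\<And>j. j < b \<Longrightarrow> a' j \<in> A) \<Longrightarrow>
    tuple b (\<lambda>j. a j + a' j) = tuple b a \<oplus>\<^bsub>free_module R b\<^esub> tuple b a'"
  by (simp add: tuple_def free_module_def fun_eq_iff psi_eq_iff add_mem phi_add phi_psi psi_mem restrict_def)

lemma tuple_smult:
  "(\<And>j. j < b \<Longrightarrow> a j \<in> A) \<Longrightarrow> c \<in> carrier R \<Longrightarrow>
    tuple b (\<lambda>j. \<phi> c * a j) = c \<odot>\<^bsub>free_module R b\<^esub> tuple b a"
  by (simp add: tuple_def free_module_def fun_eq_iff psi_eq_iff mult_mem phi_mem phi_mult phi_psi psi_mem restrict_def)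

lemma tuple_zero_iff:
  "(\<And>j. j < b \<Longrightarrow> a j \<in> A) \<Longrightarrow> tuple b a = \<zero>\<^bsub>free_module R b\<^esub> \<longleftrightarrow> (\<forall>j<b. a j = 0)"
  by (simp add: tuple_def free_module_def fun_eq_iff psi_eq_iff phi_zero restrict_def)

lemma mem_shifted_grading_iff:
  "x \<in> shifted_grading R G i b t \<longleftrightarrow> x \<in> carrier (free_module R b) \<and>
     (\<forall>k<b. if i \<le> t then untuple b x k \<in> H (t - i) else untuple b x k = 0)"
proof -
  have "x k \<in> (if i \<le> t then G (t - i) else {\<zero>\<^bsub>R\<^esub>}) \<longleftrightarrow>
      x k \<in> carrier R \<and> (if i \<le> t then \<phi> (x k) \<in> H (t - i) else \<phi> (x k) = 0)" for k
    using mem_G_iff[of "x k" "t - i"] G_carrier phi_inject[of "x k" "\<zero>\<^bsub>R\<^esub>"] phi_zero by auto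
  then show ?thesis
    unfolding shifted_grading_def free_module_def untuple_def PiE_def Pi_def by auto
qed

end

section \<open>From linear syzygies to a linear free resolution\<close>

context graded_ring_iso
begin

abbreviation M where "M \<equiv> residue_class_field R G"

lemma M_simps [simp]:
  "carrier M = carrier (R Quot I)" "x \<oplus>\<^bsub>M\<^esub> y = x \<oplus>\<^bsub>R Quot I\<^esub> y" "\<zero>\<^bsub>M\<^esub> = I"
  "a \<odot>\<^bsub>M\<^esub> x = (I +>\<^bsub>R\<^esub> a) \<otimes>\<^bsub>R Quot I\<^esub> x"
  by (simp_all add: residue_class_field_def residue_module_def FactRing_def)

lemma coset_mem: "x \<in> carrier R \<Longrightarrow> I +>\<^bsub>R\<^esub> x \<in> carrier (R Quot I)"
  using I.rcos_ring_hom by (rule ring_hom_closed)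

lemma mem_G_pos_I: "x \<in> G t \<Longrightarrow> t > 0 \<Longrightarrow> x \<in> I"
  using mem_I_iff[of x] G_carrier[of t] mem_G_iff[of x t] xs_generate[of t] by auto

definition differential :: "nat \<Rightarrow> nat \<Rightarrow> (nat \<Rightarrow> 'r) list \<Rightarrow> (nat \<Rightarrow> 'a) \<Rightarrow> nat \<Rightarrow> 'a" where
  "differential b b' gs x = tuple b (comb gs (untuple b' x))"

lemma comb_mem_A:
  assumes "\<And>g j. g \<in> set gs \<Longrightarrow> g j \<in> A" "\<And>k. c k \<in> A"
  shows "comb gs c j \<in> A"
  unfolding comb_def using assms by (auto intro!: sum_mem mult_mem)

text \<open>The matrix entries are linear, so the degree of coordinates rises by one, just as the
  shift drops from \<open>Suc i\<close> to \<open>i\<close>.\<close>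

lemma differential_graded_hom:
  assumes gs: "\<And>g j. g \<in> set gs \<Longrightarrow> g j \<in> H 1"
    and len: "length gs = b'"
  shows "differential b b' gs \<in> graded_hom R
    (free_module R b') (shifted_grading R G (Suc i) b') (free_module R b) (shifted_grading R G i b)"
proof -
  have gsA: "g j \<in> A" if "g \<in> set gs" for g j
    using gs[OF that, of j] H_subset by auto
  have mem: "comb gs (untuple b' x) j \<in> A" if "x \<in> carrier (free_module R b')" for x j
    using untuple_mem[OF that] gsA by (intro comb_mem_A)
  have add: "comb gs (\<lambda>k. c k + c' k) = (\<lambda>j. comb gs c j + comb gs c' j)" for c c'
    by (simp add: fun_eq_iff comb_def distrib_right sum.distrib)
  have smult: "comb gs (\<lambda>k. a * c k) = (\<lambda>j. a * comb gs c j)" for a c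
    by (simp add: fun_eq_iff comb_def sum_distrib_left mult.assoc)
  show ?thesis
    unfolding graded_hom_def mod_hom_def
  proof (intro CollectI conjI ballI allI subsetI Pi_I)
    fix x assume x: "x \<in> carrier (free_module R b')"
    show "differential b b' gs x \<in> carrier (free_module R b)"
      unfolding differential_def using mem[OF x] by (intro tuple_mem)
    fix y assume y: "y \<in> carrier (free_module R b')"
    have "untuple b' (x \<oplus>\<^bsub>free_module R b'\<^esub> y) = (\<lambda>k. untuple b' x k + untuple b' y k)"
      using untuple_add[OF x y] by auto
    then show "differential b b' gs (x \<oplus>\<^bsub>free_module R b'\<^esub> y) =
        differential b b' gs x \<oplus>\<^bsub>free_module R b\<^esub> differential b b' gs y"
      unfolding differential_def using mem[OF x] mem[OF y] by (simp add: add tuple_add)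
  next
    fix a x assume a: "a \<in> carrier R" and x: "x \<in> carrier (free_module R b')"
    have "untuple b' (a \<odot>\<^bsub>free_module R b'\<^esub> x) = (\<lambda>k. \<phi> a * untuple b' x k)"
      using untuple_smult[OF x a] by auto
    then show "differential b b' gs (a \<odot>\<^bsub>free_module R b'\<^esub> x) =
        a \<odot>\<^bsub>free_module R b\<^esub> differential b b' gs x"
      unfolding differential_def using mem[OF x] a by (simp add: smult tuple_smult)
  next
    fix t y assume "y \<in> differential b b' gs ` shifted_grading R G (Suc i) b' t"
    then obtain x where x: "x \<in> shifted_grading R G (Suc i) b' t" and y: "y = differential b b' gs x"
      by auto
    have x': "x \<in> carrier (free_module R b')" using x by (simp add: mem_shifted_grading_iff)
    have "if i \<le> t then comb gs (untuple b' x) j \<in> H (t - i) else comb gs (untuple b' x) j = 0" for j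
    proof (cases "Suc i \<le> t")
      case True
      have "untuple b' x k * (gs ! k) j \<in> H (t - i)" if "k < b'" for k
      proof -
        have "untuple b' x k * (gs ! k) j \<in> H (t - Suc i + 1)"
          using that x True len by (intro mult_mem_H gs) (auto simp: mem_shifted_grading_iff)
        moreover have "t - Suc i + 1 = t - i" using True by simp
        ultimately show ?thesis by simp
      qed
      then show ?thesis unfolding comb_def using True len by (auto intro: sum_mem_H)
    next
      \<comment> \<open>In degrees up to \<open>i\<close> the source component is zero.\<close>
      case False
      then have "comb gs (untuple b' x) j = 0"
        using x len by (intro comb_zero) (auto simp: mem_shifted_grading_iff)
      then show ?thesis by (simp add: zero_mem_H)
    qed
    then show "y \<in> shifted_grading R G i b t"
      unfolding y mem_shifted_grading_iff differential_def
      using mem[OF x'] by (auto simp: tuple_mem) (auto simp: untuple_def tuple_def phi_psi split: if_splits)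
  qed
qed

lemma differential_image:
  assumes "\<And>g j. g \<in> set gs \<Longrightarrow> g j \<in> A" and len: "length gs = b'"
  shows "differential b b' gs ` carrier (free_module R b') = tuple b ` vspan gs"
proof -
  have "comb gs ` untuple b' ` carrier (free_module R b') = vspan gs"
  proof (intro equalityI subsetI)
    fix a assume "a \<in> vspan gs"
    then obtain c where c: "\<forall>k. c k \<in> A" "a = comb gs c" by (auto simp: vspan_def)
    define c' where "c' = (\<lambda>k. if k < b' then c k else 0)"
    have "untuple b' (tuple b' c') = c'"
      using c by (intro untuple_tuple) (auto simp: c'_def)
    moreover have "comb gs c = comb gs c'"
      using len by (auto simp: c'_def intro!: ext comb_cong)
    moreover have "tuple b' c' \<in> carrier (free_module R b')"
      using c by (intro tuple_mem) (auto simp: c'_def)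
    ultimately show "a \<in> comb gs ` untuple b' ` carrier (free_module R b')"
      unfolding c(2) by (metis imageI)
  qed (auto simp: vspan_def untuple_mem)
  then show ?thesis unfolding differential_def[abs_def] by (metis image_image)
qed

lemma differential_kernel:
  assumes gs: "\<And>g j. g \<in> set gs \<Longrightarrow> g j \<in> A" and len: "length gs = b'"
    and supp: "\<And>g j. g \<in> set gs \<Longrightarrow> j \<ge> b \<Longrightarrow> g j = 0"
  shows "a_kernel (free_module R b') (free_module R b) (differential b b' gs) = tuple b' ` syz gs"
proof -
  have "differential b b' gs x = \<zero>\<^bsub>free_module R b\<^esub> \<longleftrightarrow> untuple b' x \<in> syz gs"
    if x: "x \<in> carrier (free_module R b')" for x
  proof -
    have "comb gs (untuple b' x) j = 0" if "j \<ge> b" for j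
      unfolding comb_def using supp[OF nth_mem that] by (intro sum.neutral) simp
    then have "(\<forall>j<b. comb gs (untuple b' x) j = 0) \<longleftrightarrow> (\<forall>j. comb gs (untuple b' x) j = 0)"
      by (meson not_le)
    moreover have "differential b b' gs x = \<zero>\<^bsub>free_module R b\<^esub> \<longleftrightarrow> (\<forall>j<b. comb gs (untuple b' x) j = 0)"
      unfolding differential_def using untuple_mem[OF x] gs by (intro tuple_zero_iff comb_mem_A)
    moreover have "untuple b' x k = 0" if "k \<ge> b'" for k using that by (simp add: untuple_def)
    ultimately show ?thesis
      using untuple_mem[OF x] len by (auto simp: syz_def)
  qed
  then have "a_kernel (free_module R b') (free_module R b) (differential b b' gs) =
      {x \<in> carrier (free_module R b'). untuple b' x \<in> syz gs}"
    unfolding a_kernel_def kernel_def by auto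
  also have "\<dots> = tuple b' ` syz gs"
  proof (intro equalityI subsetI)
    fix x assume "x \<in> {x \<in> carrier (free_module R b'). untuple b' x \<in> syz gs}"
    then show "x \<in> tuple b' ` syz gs" using tuple_untuple[of x b'] by force
  next
    fix x assume "x \<in> tuple b' ` syz gs"
    then obtain a where a: "a \<in> syz gs" "x = tuple b' a" by auto
    then have "untuple b' x = a" using len by (auto simp: syz_def intro!: untuple_tuple)
    with a show "x \<in> {x \<in> carrier (free_module R b'). untuple b' x \<in> syz gs}"
      by (auto simp: syz_def intro!: tuple_mem)
  qed
  finally show ?thesis .
qed

lemma mem_vspan: 
  assumes "g \<in> set gs"
  shows "g \<in> vspan gs"
proof -
  from assms obtain p where p: "p < length gs" "g = gs ! p" by (auto simp: in_set_conv_nth)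
  have "comb gs (\<lambda>k. if k = p then 1 else 0) j = g j" for j
  proof -
    have "comb gs (\<lambda>k. if k = p then 1 else 0) j = (\<Sum>k<length gs. if k = p then g j else 0)"
      unfolding comb_def using p by (intro sum.cong) auto
    with p show ?thesis by simp
  qed
  then show ?thesis
    unfolding vspan_def
    by (intro CollectI exI[of _ "\<lambda>k. if k = p then 1 else 0"]) (auto simp: one_mem zero_mem)
qed

text \<open>The vectors in \<open>gss i\<close> are the images of the basis under the map from step
  \<open>i + 1\<close> to step \<open>i\<close>. The first assumption is exactness at step 0, where
  the kernel of the augmentation is the irrelevant ideal; the second is exactness at the later
  steps.\<close>

theorem koszul_algebraI:
  assumes gss0: "vspan (gss 0) = {a. a 0 \<in> ideal_span xs \<and> (\<forall>j>0. a j = 0)}"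
    and gss_Suc: "\<And>i. vspan (gss (Suc i)) = syz (gss i)"
    and lin: "\<And>i g j. g \<in> set (gss i) \<Longrightarrow> g j \<in> H 1"
  shows "koszul_algebra R G"
proof -
  \<comment> \<open>The residue field is cyclic, hence rank 1 at step 0.\<close>
  define b where "b i = (case i of 0 \<Rightarrow> 1 | Suc i \<Rightarrow> length (gss i))" for i
  define d where "d i = differential (b i) (b (Suc i)) (gss i)" for i
  define e where "e x = I +>\<^bsub>R\<^esub> x 0" for x :: "nat \<Rightarrow> 'a"
  have b: "b 0 = 1" "\<And>i. length (gss i) = b (Suc i)" by (simp_all add: b_def)
  have gsA: "g j \<in> A" if "g \<in> set (gss i)" for g i j
    using lin[OF that, of j] H_subset by auto
  have supp: "g j = 0" if "g \<in> set (gss i)" "j \<ge> b i" for g i j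
    using mem_vspan[OF that(1)] that(2)
    by (cases i) (auto simp: gss0 gss_Suc syz_def b_def)
  have entry: "x 0 \<in> carrier R" if "x \<in> carrier (free_module R 1)" for x
    using that by (rule free_module_entry) simp
  have "e \<in> graded_hom R (free_module R 1) (shifted_grading R G 0 1) M (degree_zero_grading M)"
    unfolding graded_hom_def mod_hom_def
  proof (intro CollectI conjI ballI allI subsetI Pi_I)
    fix x assume x: "x \<in> carrier (free_module R 1)"
    show "e x \<in> carrier M" using entry[OF x] by (simp add: e_def coset_mem)
    fix y assume y: "y \<in> carrier (free_module R 1)"
    have "(x \<oplus>\<^bsub>free_module R 1\<^esub> y) 0 = x 0 \<oplus>\<^bsub>R\<^esub> y 0" by (simp add: free_module_def)
    then show "e (x \<oplus>\<^bsub>free_module R 1\<^esub> y) = e x \<oplus>\<^bsub>M\<^esub> e y"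
      using ring_hom_add[OF I.rcos_ring_hom entry[OF x] entry[OF y]] by (simp add: e_def)
  next
    fix a x assume a: "a \<in> carrier R" and x: "x \<in> carrier (free_module R 1)"
    have "(a \<odot>\<^bsub>free_module R 1\<^esub> x) 0 = a \<otimes>\<^bsub>R\<^esub> x 0" by (simp add: free_module_def)
    then show "e (a \<odot>\<^bsub>free_module R 1\<^esub> x) = a \<odot>\<^bsub>M\<^esub> e x"
      using ring_hom_mult[OF I.rcos_ring_hom a entry[OF x]] by (simp add: e_def)
  next
    fix t y assume "y \<in> e ` shifted_grading R G 0 1 t"
    then obtain x where "x \<in> {..<1} \<rightarrow>\<^sub>E G t" and y: "y = e x"
      unfolding shifted_grading_def by (simp only: le0 if_True diff_zero) (rule imageE)
    then have x: "x 0 \<in> G t" by (auto dest: PiE_mem)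
    have "x 0 \<in> carrier R" using x G_carrier by blast
    then show "y \<in> degree_zero_grading M t"
      using mem_G_pos_I[OF x] coset_eq_I_iff[of "x 0"]
      by (auto simp: y degree_zero_grading_def e_def coset_mem)
  qed
  moreover have "d i \<in> graded_hom R (free_module R (b (Suc i))) (shifted_grading R G (Suc i) (b (Suc i)))
      (free_module R (b i)) (shifted_grading R G i (b i))" for i
    unfolding d_def using lin b(2) by (rule differential_graded_hom)
  moreover have "e ` carrier (free_module R 1) = carrier M"
  proof (intro equalityI subsetI)
    fix y assume "y \<in> carrier M"
    then obtain r where "r \<in> carrier R" "y = I +>\<^bsub>R\<^esub> r"
      by (auto simp: FactRing_def A_RCOSETS_def')
    then show "y \<in> e ` carrier (free_module R 1)"
      by (intro image_eqI[of _ _ "\<lambda>j\<in>{..<1}. r"]) (auto simp: e_def free_module_def)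
  qed (use entry in \<open>auto simp: e_def coset_mem\<close>)
  moreover have image: "d i ` carrier (free_module R (b (Suc i))) = tuple (b i) ` vspan (gss i)" for i
    unfolding d_def using gsA b(2) by (rule differential_image)
  have "d 0 ` carrier (free_module R (b 1)) = a_kernel (free_module R 1) M e"
  proof -
    have "a_kernel (free_module R 1) M e = {x \<in> carrier (free_module R 1). x 0 \<in> I}"
      unfolding a_kernel_def kernel_def using coset_eq_I_iff[OF entry] by (auto simp: e_def)
    also have "\<dots> = {x \<in> carrier (free_module R 1). \<phi> (x 0) \<in> ideal_span xs}"
      using entry mem_I_iff by auto
    also have "\<dots> = tuple 1 ` {a. a 0 \<in> ideal_span xs \<and> (\<forall>j>0. a j = 0)}" (is "?L = ?R")
    proof (intro equalityI subsetI)
      fix x assume x: "x \<in> ?L"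
      then show "x \<in> ?R"
        by (intro image_eqI[of _ _ "untuple 1 x"]) (auto simp: tuple_untuple untuple_def)
    next
      fix x assume "x \<in> ?R"
      then obtain a where a: "x = tuple 1 a" "a 0 \<in> ideal_span xs" by auto
      have "ideal_span xs \<subseteq> A" using xs_linear H_subset by (intro ideal_span_subset) blast
      with a show "x \<in> ?L"
        by (auto intro!: tuple_mem) (auto simp: tuple_def phi_psi)
    qed
    finally show ?thesis using image[of 0] gss0 b(1) by simp
  qed
  moreover have "d (Suc i) ` carrier (free_module R (b (Suc (Suc i)))) =
      a_kernel (free_module R (b (Suc i))) (free_module R (b i)) (d i)" for i
    unfolding image gss_Suc unfolding d_def
    using gsA b(2) supp by (rule differential_kernel[symmetric])
  ultimately show ?thesis
    unfolding koszul_algebra_def has_linear_free_resolution_def is_linear_free_resolution_def Let_def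
    using b(1) by (intro exI[of _ b] exI[of _ d] exI[of _ e]) simp
qed

end

section \<open>The first two matrices of a given linear resolution\<close>

context graded_ring_iso
begin

definition basis_vector :: "nat \<Rightarrow> nat \<Rightarrow> nat \<Rightarrow> 'a" where
  "basis_vector b k = tuple b (\<lambda>j. if j = k then 1 else 0)"

lemma basis_vector_mem: "basis_vector b k \<in> carrier (free_module R b)"
  unfolding basis_vector_def by (intro tuple_mem) (auto simp: one_mem zero_mem)

lemma untuple_zero: "untuple b \<zero>\<^bsub>free_module R b\<^esub> k = 0"
  by (simp add: untuple_def free_module_def phi_zero)

lemma free_module_closed:
  assumes "x \<in> carrier (free_module R b)"
  shows "y \<in> carrier (free_module R b) \<Longrightarrow> x \<oplus>\<^bsub>free_module R b\<^esub> y \<in> carrier (free_module R b)"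
    "a \<in> carrier R \<Longrightarrow> a \<odot>\<^bsub>free_module R b\<^esub> x \<in> carrier (free_module R b)"
  using assms unfolding free_module_def by (auto simp: PiE_iff)

lemma free_module_eqI:
  assumes "x \<in> carrier (free_module R b)" "y \<in> carrier (free_module R b)"
    and "\<And>k. untuple b x k = untuple b y k"
  shows "x = y"
  using assms(3) tuple_untuple[OF assms(1)] tuple_untuple[OF assms(2)] by (metis ext)

lemma mod_hom_matrix:
  assumes f: "f \<in> mod_hom R (free_module R b) (free_module R b')"
    and x: "x \<in> carrier (free_module R b)"
  shows "untuple b' (f x) j = (\<Sum>k<b. untuple b x k * untuple b' (f (basis_vector b k)) j)"
proof -
  let ?F = "free_module R b" and ?F' = "free_module R b'"
  have f_mem: "f y \<in> carrier ?F'" if "y \<in> carrier ?F" for y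
    using f that by (auto simp: mod_hom_def)
  \<comment> \<open>The truncation of \<open>x\<close> to its first \<open>l\<close> coordinates;
    linearity is unfolded by adding one coordinate at a time.\<close>
  define p where "p l = tuple b (\<lambda>j. if j < l then untuple b x j else 0)" for l
  have p_mem: "p l \<in> carrier ?F" for l
    unfolding p_def by (intro tuple_mem) (auto simp: untuple_mem[OF x] zero_mem)
  have p_untuple: "untuple b (p l) j = (if j < l then untuple b x j else 0)" for l j
    unfolding p_def
    by (subst untuple_tuple) (auto simp: untuple_mem[OF x] zero_mem, simp add: untuple_def)
  have "untuple b' (f (p l)) j = (\<Sum>k<l. untuple b x k * untuple b' (f (basis_vector b k)) j)"
    if "l \<le> b" for l
    using that
  proof (induction l)
    case 0
    \<comment> \<open>That zero is sent to zero is not part of \<open>mod_hom\<close>; it follows by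
      cancellation from \<open>p 0\<close> being its own double.\<close>
    have "p 0 \<oplus>\<^bsub>?F\<^esub> p 0 = p 0"
      by (rule free_module_eqI[of _ b]) (simp_all add: free_module_closed p_mem untuple_add p_untuple)
    moreover have "f (p 0 \<oplus>\<^bsub>?F\<^esub> p 0) = f (p 0) \<oplus>\<^bsub>?F'\<^esub> f (p 0)"
      using f p_mem by (auto simp: mod_hom_def)
    ultimately have "untuple b' (f (p 0)) j = untuple b' (f (p 0)) j + untuple b' (f (p 0)) j"
      using untuple_add[OF f_mem f_mem, OF p_mem p_mem, of 0 0 j] by simp
    then show ?case by simp
  next
    case (Suc l)
    let ?s = "x l \<odot>\<^bsub>?F\<^esub> basis_vector b l"
    have xl: "x l \<in> carrier R" using free_module_entry[OF x] Suc.prems by simp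
    have s_mem: "?s \<in> carrier ?F" by (intro free_module_closed basis_vector_mem xl)
    have "p (Suc l) = p l \<oplus>\<^bsub>?F\<^esub> ?s"
    proof (rule free_module_eqI[of _ b])
      fix k
      have "untuple b (basis_vector b l) = (\<lambda>j. if j = l then 1 else 0)"
        unfolding basis_vector_def using Suc.prems by (intro untuple_tuple) (auto simp: one_mem zero_mem)
      then show "untuple b (p (Suc l)) k = untuple b (p l \<oplus>\<^bsub>?F\<^esub> ?s) k"
        using Suc.prems
        by (auto simp: untuple_add p_mem s_mem p_untuple untuple_smult basis_vector_mem xl untuple_def[of b x] less_Suc_eq)
    qed (simp_all add: free_module_closed p_mem s_mem)
    moreover have "f (p l \<oplus>\<^bsub>?F\<^esub> ?s) = f (p l) \<oplus>\<^bsub>?F'\<^esub> f ?s"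
      using f p_mem s_mem by (auto simp: mod_hom_def)
    moreover have "f ?s = x l \<odot>\<^bsub>?F'\<^esub> f (basis_vector b l)"
      using f xl basis_vector_mem by (auto simp: mod_hom_def)
    ultimately have "untuple b' (f (p (Suc l))) j =
        untuple b' (f (p l)) j + \<phi> (x l) * untuple b' (f (basis_vector b l)) j"
      using f_mem p_mem s_mem basis_vector_mem xl
      by (simp add: untuple_add untuple_smult free_module_closed)
    with Suc show ?case by (simp add: untuple_def[of b x])
  qed
  moreover have "p b = x"
    by (rule free_module_eqI[of _ b]) (simp_all add: p_mem x p_untuple, simp add: untuple_def)
  ultimately show ?thesis by (metis order.refl)
qed

lemma basis_vector_homogeneous: "basis_vector b k \<in> shifted_grading R G i b i"
proof -
  have "untuple b (basis_vector b k) j \<in> H 0" if "j < b" for j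
    using that by (auto simp: untuple_def basis_vector_def tuple_def phi_psi one_mem zero_mem one_mem_H zero_mem_H)
  then show ?thesis by (simp add: mem_shifted_grading_iff basis_vector_mem)
qed

lemma graded_hom_matrix_linear:
  assumes f: "f \<in> graded_hom R (free_module R b) (shifted_grading R G (Suc i) b)
    (free_module R b') (shifted_grading R G i b')"
    and j: "j < b'"
  shows "untuple b' (f (basis_vector b k)) j \<in> H 1"
proof -
  have "f (basis_vector b k) \<in> shifted_grading R G i b' (Suc i)"
    using f basis_vector_homogeneous unfolding graded_hom_def by blast
  with j show ?thesis by (simp add: mem_shifted_grading_iff)
qed

text \<open>The rows of \<open>Y\<close> and \<open>Z\<close> are the images of the basis vectors of
  steps 1 and 2, and exactness at step 1 says that the rows of \<open>Z\<close> generate the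
  relations among the rows of \<open>Y\<close>. A linear \<open>x\<close> annihilates the residue
  field, so \<open>x\<close> times the first basis vector of step 0 is in the image of
  \<open>d 0\<close>. This last fact recovers the variables from \<open>Y\<close> whatever the bases
  are.\<close>

theorem koszul_algebraD:
  assumes "koszul_algebra R G"
  obtains b0 b1 b2 :: nat and Y Z :: "nat \<Rightarrow> nat \<Rightarrow> 'r" where "b0 > 0"
    "\<And>k j. k < b1 \<Longrightarrow> j < b0 \<Longrightarrow> Y k j \<in> H 1"
    "\<And>l k. l < b2 \<Longrightarrow> k < b1 \<Longrightarrow> Z l k \<in> H 1"
    "\<And>l j. l < b2 \<Longrightarrow> j < b0 \<Longrightarrow> (\<Sum>k<b1. Z l k * Y k j) = 0"
    "\<And>a. (\<And>k. k < b1 \<Longrightarrow> a k \<in> A) \<Longrightarrow> (\<And>j. j < b0 \<Longrightarrow> (\<Sum>k<b1. a k * Y k j) = 0) \<Longrightarrow>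
      \<exists>c. (\<forall>l<b2. c l \<in> A) \<and> (\<forall>k<b1. a k = (\<Sum>l<b2. c l * Z l k))"
    "\<And>x. x \<in> H 1 \<Longrightarrow> \<exists>z. (\<forall>k<b1. z k \<in> H 0) \<and>
      (\<forall>j<b0. (\<Sum>k<b1. z k * Y k j) = (if j = 0 then x else 0))"
proof -
  obtain b d e where
    e: "e \<in> graded_hom R (free_module R (b 0)) (shifted_grading R G 0 (b 0)) M (degree_zero_grading M)"
    and d': "\<forall>i. d i \<in> graded_hom R (free_module R (b (Suc i))) (shifted_grading R G (Suc i) (b (Suc i)))
      (free_module R (b i)) (shifted_grading R G i (b i))"
    and e_surj: "e ` carrier (free_module R (b 0)) = carrier M"
    and exact0: "d 0 ` carrier (free_module R (b 1)) = a_kernel (free_module R (b 0)) M e"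
    and exact': "\<forall>i. d (Suc i) ` carrier (free_module R (b (Suc (Suc i)))) =
      a_kernel (free_module R (b (Suc i))) (free_module R (b i)) (d i)"
    using assms
    unfolding koszul_algebra_def has_linear_free_resolution_def is_linear_free_resolution_def Let_def
    by (elim exE conjE) (rule that)
  note d = d'[rule_format] and exact = exact'[rule_format]
  define Y where "Y k j = untuple (b 0) (d 0 (basis_vector (b 1) k)) j" for k j
  define Z where "Z l k = untuple (b 1) (d 1 (basis_vector (b 2) l)) k" for l k
  have d0: "d 0 \<in> mod_hom R (free_module R (b 1)) (free_module R (b 0))"
    and d1: "d 1 \<in> mod_hom R (free_module R (b 2)) (free_module R (b 1))"
    using d[of 0] d[of 1] by (simp_all add: graded_hom_def numeral_2_eq_2)
  have matrix0: "untuple (b 0) (d 0 x) j = (\<Sum>k<b 1. untuple (b 1) x k * Y k j)"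
    if "x \<in> carrier (free_module R (b 1))" for x j
    unfolding Y_def using d0 that by (rule mod_hom_matrix)
  have matrix1: "untuple (b 1) (d 1 x) j = (\<Sum>k<b 2. untuple (b 2) x k * Z k j)"
    if "x \<in> carrier (free_module R (b 2))" for x j
    unfolding Z_def using d1 that by (rule mod_hom_matrix)
  have exact1: "d 1 ` carrier (free_module R (b 2)) =
      {x \<in> carrier (free_module R (b 1)). d 0 x = \<zero>\<^bsub>free_module R (b 0)\<^esub>}"
    using exact[of 0] by (simp add: a_kernel_def kernel_def numeral_2_eq_2)
  have zero_free: "\<zero>\<^bsub>free_module R (b 0)\<^esub> \<in> carrier (free_module R (b 0))"
    by (simp add: free_module_def)
  \<comment> \<open>Otherwise the residue field would have only one element.\<close>
  have "b 0 > 0"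
  proof (rule ccontr)
    assume "\<not> b 0 > 0"
    then have *: "carrier (free_module R (b 0)) = {\<lambda>_. undefined}" by (simp add: free_module_def)
    have "carrier M = {e (\<lambda>_. undefined)}" using e_surj unfolding * by simp
    moreover have "I +>\<^bsub>R\<^esub> \<one>\<^bsub>R\<^esub> \<in> carrier M" "I +>\<^bsub>R\<^esub> \<zero>\<^bsub>R\<^esub> \<in> carrier M"
      by (simp_all add: coset_mem)
    ultimately have "I +>\<^bsub>R\<^esub> \<one>\<^bsub>R\<^esub> = I +>\<^bsub>R\<^esub> \<zero>\<^bsub>R\<^esub>" by auto
    moreover have "I +>\<^bsub>R\<^esub> \<zero>\<^bsub>R\<^esub> = I" by (simp add: coset_eq_I_iff)
    ultimately have "\<one>\<^bsub>R\<^esub> \<in> I" by (simp add: coset_eq_I_iff)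
    then show False using xs_proper by (simp add: mem_I_iff phi_one)
  qed
  have Y: "Y k j \<in> H 1" if "k < b 1" "j < b 0" for k j
    unfolding Y_def using graded_hom_matrix_linear[OF d[of 0] that(2)] by simp
  have "Z l k \<in> H 1" if "l < b 2" "k < b 1" for l k
    unfolding Z_def using graded_hom_matrix_linear[OF d[of 1], of k] that by (simp add: numeral_2_eq_2)
  have "(\<Sum>k<b 1. Z l k * Y k j) = 0" if "l < b 2" "j < b 0" for l j
  proof -
    have "d 1 (basis_vector (b 2) l) \<in> d 1 ` carrier (free_module R (b 2))"
      using basis_vector_mem by blast
    then have "d 1 (basis_vector (b 2) l) \<in> carrier (free_module R (b 1))"
      "d 0 (d 1 (basis_vector (b 2) l)) = \<zero>\<^bsub>free_module R (b 0)\<^esub>"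
      unfolding exact1 by auto
    with matrix0[of "d 1 (basis_vector (b 2) l)" j] show ?thesis
      by (simp add: untuple_zero Z_def)
  qed
  have "\<exists>c. (\<forall>l<b 2. c l \<in> A) \<and> (\<forall>k<b 1. a k = (\<Sum>l<b 2. c l * Z l k))"
    if a: "\<And>k. k < b 1 \<Longrightarrow> a k \<in> A" and syz: "\<And>j. j < b 0 \<Longrightarrow> (\<Sum>k<b 1. a k * Y k j) = 0" for a
  proof -
    let ?x = "tuple (b 1) a"
    have x: "?x \<in> carrier (free_module R (b 1))" using a by (rule tuple_mem)
    have untuple: "untuple (b 1) ?x k = a k" if "k < b 1" for k
      using that a by (simp add: untuple_def tuple_def phi_psi)
    have "untuple (b 0) (d 0 ?x) j = 0" for j
      using matrix0[OF x, of j] syz[of j] untuple by (cases "j < b 0") (simp_all add: untuple_def[of "b 0"])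
    then have "d 0 ?x = \<zero>\<^bsub>free_module R (b 0)\<^esub>"
      using d0 x zero_free by (intro free_module_eqI[of _ "b 0"]) (auto simp: mod_hom_def untuple_zero)
    with x exact1 obtain y where "y \<in> carrier (free_module R (b 2))" "?x = d 1 y" by auto
    then show ?thesis
      using matrix1[of y] untuple
      by (intro exI[of _ "untuple (b 2) y"]) (auto simp: untuple_mem)
  qed
  have "\<exists>z. (\<forall>k<b 1. z k \<in> H 0) \<and>
      (\<forall>j<b 0. (\<Sum>k<b 1. z k * Y k j) = (if j = 0 then x else 0))" if x: "x \<in> H 1" for x
  proof -
    have xA: "x \<in> A" using x H_subset by auto
    let ?r = "\<psi> x" and ?v = "basis_vector (b 0) 0"
    have r: "?r \<in> carrier R" "?r \<in> I"
      using x xA xs_generate[of 1] by (auto simp: psi_mem mem_I_iff phi_psi)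
    let ?s = "?r \<odot>\<^bsub>free_module R (b 0)\<^esub> ?v"
    have s: "?s \<in> carrier (free_module R (b 0))" by (intro free_module_closed basis_vector_mem r)
    have ev: "e ?v \<in> carrier (R Quot I)"
      using e basis_vector_mem[of "b 0" 0] by (auto simp: graded_hom_def mod_hom_def)
    have "e ?s = ?r \<odot>\<^bsub>M\<^esub> e ?v"
      using e r basis_vector_mem[of "b 0" 0] unfolding graded_hom_def mod_hom_def by blast
    also have "\<dots> = \<zero>\<^bsub>R Quot I\<^esub> \<otimes>\<^bsub>R Quot I\<^esub> e ?v"
      using r coset_eq_I_iff[of ?r] by (simp add: FactRing_def)
    also have "\<dots> = \<zero>\<^bsub>R Quot I\<^esub>"
      using ring.ring_simprules(24)[OF I.quotient_is_ring ev] by simp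
    finally have "e ?s = \<zero>\<^bsub>M\<^esub>" by (simp add: FactRing_def)
    then have "?s \<in> d 0 ` carrier (free_module R (b 1))"
      unfolding exact0 a_kernel_def kernel_def using s by simp
    then obtain y where y: "y \<in> carrier (free_module R (b 1))" "?s = d 0 y" by auto
    \<comment> \<open>Since \<open>x\<close> and the entries of \<open>Y\<close> are linear, the
      degree 0 components of the coefficients already give the combination, so constants
      suffice.\<close>
    have "(\<Sum>k<b 1. cmp 0 (untuple (b 1) y k) * Y k j) = (if j = 0 then x else 0)" if "j < b 0" for j
    proof -
      have "(\<Sum>k<b 1. cmp 0 (untuple (b 1) y k) * Y k j) = cmp (Suc 0) (\<Sum>k<b 1. untuple (b 1) y k * Y k j)"
        unfolding cmp_sum using Y[OF _ that] untuple_mem[OF y(1)]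
        by (intro sum.cong refl cmp_mult[symmetric]) simp_all
      also have "(\<Sum>k<b 1. untuple (b 1) y k * Y k j) = untuple (b 0) ?s j"
        unfolding y(2) using matrix0[OF y(1)] by simp
      also have "\<dots> = (if j = 0 then x else 0)"
        using that xA r by (simp add: untuple_smult basis_vector_mem phi_psi)
          (simp add: untuple_def basis_vector_def tuple_def phi_psi one_mem zero_mem)
      also have "cmp (Suc 0) \<dots> = \<dots>" using x by (simp add: cmp_id cmp_zero)
      finally show ?thesis .
    qed
    then show ?thesis
      using untuple_mem[OF y(1)] cmp_mem by (intro exI[of _ "\<lambda>k. cmp 0 (untuple (b 1) y k)"]) auto
  qed
  show ?thesis
    by (rule that[of "b 0" "b 1" Y "b 2" Z]; fact)
qed

end

section \<open>Ideals generated by variables\<close>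

definition gen :: "nat \<Rightarrow> nat \<times> nat \<Rightarrow>\<^sub>0 'k::comm_ring_1" where
  "gen e = single (e, 1) 1"

text \<open>The monomials of the ideal generated by the variables with index in
  \<open>W\<close>.\<close>

definition translates :: "nat set \<Rightarrow> nat set \<Rightarrow> (nat \<times> nat) set" where
  "translates E W = {s + (e, 1) |s e. s \<in> sumsets E \<and> e \<in> W}"

lemma single_mem_sumsets: "e \<in> E \<Longrightarrow> (e, 1) \<in> sumsets E"
  unfolding sumsets_def by (intro CollectI exI[of _ "{#e#}"]) auto

lemma sumsets_0: "(x, 0) \<in> sumsets E \<longleftrightarrow> x = 0"
  unfolding sumsets_def by (auto intro: exI[of _ "{#}"])

lemma sumsets_Suc: "(x, Suc t) \<in> sumsets E \<longleftrightarrow> (\<exists>e\<in>E. e \<le> x \<and> (x - e, t) \<in> sumsets E)"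
proof
  assume "(x, Suc t) \<in> sumsets E"
  then obtain w where w: "set_mset w \<subseteq> E" "sum_mset w = x" "size w = Suc t"
    by (auto simp: sumsets_def)
  from w(3) obtain e v where "w = add_mset e v" by (metis size_Suc_Diff1 insert_DiffM size_eq_Suc_imp_elem)
  with w show "\<exists>e\<in>E. e \<le> x \<and> (x - e, t) \<in> sumsets E"
    by (intro bexI[of _ e]) (auto simp: sumsets_def)
next
  assume "\<exists>e\<in>E. e \<le> x \<and> (x - e, t) \<in> sumsets E"
  then obtain e where e: "e \<in> E" "e \<le> x" "(x - e, t) \<in> sumsets E" by auto
  with add_sumsets[OF e(3) single_mem_sumsets[OF e(1)]] show "(x, Suc t) \<in> sumsets E" by simp
qed

lemma translates_iff:
  "(x, t) \<in> translates E W \<longleftrightarrow> (\<exists>e\<in>W. e \<le> x \<and> t \<ge> 1 \<and> (x - e, t - 1) \<in> sumsets E)"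
proof
  assume "\<exists>e\<in>W. e \<le> x \<and> t \<ge> 1 \<and> (x - e, t - 1) \<in> sumsets E"
  then obtain e where "e \<in> W" "e \<le> x" "t \<ge> 1" "(x - e, t - 1) \<in> sumsets E" by auto
  then show "(x, t) \<in> translates E W"
    unfolding translates_def by (intro CollectI exI[of _ "(x - e, t - 1)"] exI[of _ e]) auto
next
  assume "(x, t) \<in> translates E W"
  then obtain y u e where "x = y + e" "t = u + 1" "(y, u) \<in> sumsets E" "e \<in> W"
    by (auto simp: translates_def)
  then show "\<exists>e\<in>W. e \<le> x \<and> t \<ge> 1 \<and> (x - e, t - 1) \<in> sumsets E"
    by (intro bexI[of _ e]) auto
qed

lemma translates_subset:
  assumes "W \<subseteq> E"
  shows "translates E W \<subseteq> sumsets E"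
proof
  fix s assume "s \<in> translates E W"
  then obtain s' e where "s = s' + (e, 1)" "s' \<in> sumsets E" "e \<in> W"
    unfolding translates_def by blast
  then show "s \<in> sumsets E" using add_sumsets[of s' E "(e, 1)"] single_mem_sumsets[of e E] assms by auto
qed

lemma colon_translatesI:
  fixes z :: nat and S :: "(nat \<times> nat) set"
  assumes "\<And>x t. (x, t) \<in> S \<and> (x + z, t + 1) \<in> T \<longleftrightarrow> (x, t) \<in> T'"
  shows "{s \<in> S. s + (z, 1) \<in> T} = T'"
proof (rule Set.set_eqI)
  fix s
  show "s \<in> {s \<in> S. s + (z, 1) \<in> T} \<longleftrightarrow> s \<in> T'"
    using assms[of "fst s" "snd s"] by (cases s) simp
qed

lemma mult_single_right_lookup:
  fixes p :: "'a::cancel_comm_monoid_add \<Rightarrow>\<^sub>0 'k::comm_ring_1"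
  shows "lookup (p * single u 1) (s + u) = lookup p s"
proof (induction p rule: poly_mapping_single_induct)
  case (add s' c q)
  then show ?case
    by (auto simp: distrib_right lookup_add mult_single lookup_single when_def)
qed simp

lemma keys_mult_single:
  fixes p :: "'a::cancel_comm_monoid_add \<Rightarrow>\<^sub>0 'k::comm_ring_1"
  shows "keys (p * single u 1) = (\<lambda>s. s + u) ` keys p"
proof (intro equalityI subsetI)
  fix x assume x: "x \<in> keys (p * single u 1)"
  then obtain s where "x = s + u" using keys_mult[of p "single u 1"] by (auto split: if_splits)
  with x show "x \<in> (\<lambda>s. s + u) ` keys p" by (auto simp: in_keys_iff mult_single_right_lookup)
qed (auto simp: in_keys_iff mult_single_right_lookup)

context
  fixes E :: "nat set"
begin

interpretation graded_subring "supported (sumsets E) :: (_ \<Rightarrow>\<^sub>0 'k::comm_ring_1) set"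
    "homogeneous (sumsets E)" component
  by (rule graded_subring_supported[OF zero_sumsets add_sumsets])

lemma gen_homogeneous: "e \<in> E \<Longrightarrow> (gen e :: _ \<Rightarrow>\<^sub>0 'k::comm_ring_1) \<in> homogeneous (sumsets E) 1"
  by (auto simp: gen_def homogeneous_def single_mem_sumsets simp del: One_nat_def)

lemma ideal_span_gen:
  assumes "set es \<subseteq> E"
  shows "ideal_span (map gen es) = (supported (translates E (set es)) :: (_ \<Rightarrow>\<^sub>0 'k::comm_ring_1) set)"
proof (intro equalityI subsetI)
  fix p :: "nat \<times> nat \<Rightarrow>\<^sub>0 'k::comm_ring_1" assume "p \<in> ideal_span (map gen es)"
  then obtain c where c: "\<forall>k. c k \<in> supported (sumsets E)" "p = (\<Sum>k<length es. c k * gen (es ! k))"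
    by (auto simp: ideal_span_def)
  have "keys (c k * gen (es ! k)) \<subseteq> translates E (set es)" if "k < length es" for k
    using c(1) that unfolding gen_def keys_mult_single translates_def supported_def by fastforce
  then show "p \<in> supported (translates E (set es))"
    unfolding c(2) supported_def using keys_sum[of "\<lambda>k. c k * gen (es ! k)" "{..<length es}"] by fast
next
  fix p :: "nat \<times> nat \<Rightarrow>\<^sub>0 'k::comm_ring_1" assume p: "p \<in> supported (translates E (set es))"
  show "p \<in> ideal_span (map gen es)"
  proof (induction p rule: poly_mapping_single_induct)
    case zero
    then show ?case by (rule zero_mem_ideal_span)
  next
    case (add s c q)
    from add p obtain s' e where s: "s = s' + (e, 1)" "s' \<in> sumsets E" "e \<in> set es"
      unfolding supported_def translates_def by blast
    from s(3) obtain k where k: "k < length es" "e = es ! k" by (auto simp: in_set_conv_nth)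
    have "gen e \<in> ideal_span (map gen es)" using ideal_span_nth[of k "map gen es"] k by simp
    then have "single s' c * gen e \<in> ideal_span (map gen es)"
      using s by (intro ideal_span_mult) (auto simp: supported_def)
    then have "single s c \<in> ideal_span (map gen es)" by (simp add: gen_def mult_single s)
    then show ?case using add by (intro ideal_span_add)
  qed
qed

lemma colon_gen:
  "colon (supported T) (gen z) = (supported {s \<in> sumsets E. s + (z, 1) \<in> T} :: (_ \<Rightarrow>\<^sub>0 'k::comm_ring_1) set)"
  unfolding colon_def by (auto simp: supported_def gen_def keys_mult_single)

text \<open>Ideals of variables, and their colons by a variable, are spanned by the monomials they
  contain, so the colon condition can be checked on sets of pairs.\<close>

lemma koszul_filtration_gen:
  assumes subset: "\<And>es. es \<in> L \<Longrightarrow> set es \<subseteq> E"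
    and colon: "\<And>es l. es \<in> L \<Longrightarrow> l < length es \<Longrightarrow> \<exists>es'\<in>L. 
      {s \<in> sumsets E. s + (es ! l, 1) \<in> translates E (set (take l es))} = translates E (set es')"
  shows "koszul_filtration (supported (sumsets E) :: (_ \<Rightarrow>\<^sub>0 'k::comm_ring_1) set) (homogeneous (sumsets E)) component
    (map gen ` L)"
proof
  fix xs :: "(_ \<Rightarrow>\<^sub>0 'k::comm_ring_1) list" assume "xs \<in> map gen ` L"
  then obtain es where es: "es \<in> L" "xs = map gen es" by auto
  then show "set xs \<subseteq> homogeneous (sumsets E) 1"
    using subset gen_homogeneous by force
  fix l assume l: "l < length xs"
  with colon es obtain es' where es': "es' \<in> L"
    "{s \<in> sumsets E. s + (es ! l, 1) \<in> translates E (set (take l es))} = translates E (set es')"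
    by fastforce
  have "set (take l es) \<subseteq> E" using subset[OF es(1)] set_take_subset by fast
  then have "ideal_span (map gen es' :: (_ \<Rightarrow>\<^sub>0 'k::comm_ring_1) list) = colon (ideal_span (take l xs)) (xs ! l)"
    using es l by (simp add: take_map ideal_span_gen subset[OF es'(1)] colon_gen es'(2) del: One_nat_def)
  then show "\<exists>ys\<in>map gen ` L. ideal_span ys = colon (ideal_span (take l xs)) (xs ! l)"
    using es'(1) by blast
qed

lemma graded_ring_iso_gen:
  fixes R :: "'a ring" and \<phi> :: "'a \<Rightarrow> nat \<times> nat \<Rightarrow>\<^sub>0 'k::comm_ring_1"
  assumes "set es = E"
    and "cring R" "bij_betw \<phi> (carrier R) (supported (sumsets E))"
    "\<phi> \<one>\<^bsub>R\<^esub> = 1"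
    "\<And>x y. x \<in> carrier R \<Longrightarrow> y \<in> carrier R \<Longrightarrow> \<phi> (x \<oplus>\<^bsub>R\<^esub> y) = \<phi> x + \<phi> y"
    "\<And>x y. x \<in> carrier R \<Longrightarrow> y \<in> carrier R \<Longrightarrow> \<phi> (x \<otimes>\<^bsub>R\<^esub> y) = \<phi> x * \<phi> y"
    "\<And>t. G t \<subseteq> carrier R" "\<And>t. \<phi> ` G t = homogeneous (sumsets E) t"
  shows "graded_ring_iso (supported (sumsets E)) (homogeneous (sumsets E)) component R G \<phi> (map gen es)"
proof (intro graded_ring_iso.intro graded_ring_iso_axioms.intro)
  show "graded_subring (supported (sumsets E) :: (_ \<Rightarrow>\<^sub>0 'k::comm_ring_1) set) (homogeneous (sumsets E)) component"
    by (rule graded_subring_axioms)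
  show "set (map gen es) \<subseteq> (homogeneous (sumsets E) 1 :: (_ \<Rightarrow>\<^sub>0 'k::comm_ring_1) set)"
    using gen_homogeneous assms(1) by auto
  have span: "ideal_span (map gen es) = (supported (translates E E) :: (_ \<Rightarrow>\<^sub>0 'k::comm_ring_1) set)"
    using assms(1) by (subst ideal_span_gen) auto
  have "(x, t) \<in> translates E E" if "(x, t) \<in> sumsets E" "t > 0" for x t
    using that by (cases t) (auto simp: translates_iff sumsets_Suc)
  then show "homogeneous (sumsets E) t \<subseteq> ideal_span (map gen es :: (_ \<Rightarrow>\<^sub>0 'k::comm_ring_1) list)" if "t > 0" for t
    using that unfolding span by (fastforce simp: homogeneous_def supported_def)
  have "(0, 0) \<notin> translates E E" by (simp add: translates_iff)
  then show "1 \<notin> ideal_span (map gen es :: (_ \<Rightarrow>\<^sub>0 'k::comm_ring_1) list)"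
    unfolding span by (simp add: supported_def zero_prod_def)
qed fact+

end

section \<open>The sufficient condition\<close>

context
  fixes a D :: nat and E :: "nat set"
  assumes a: "a \<ge> 1" and D: "2 * a \<le> D" and E: "E = insert 0 {a..D}"
begin

lemma sumsets_interval: "(x, t) \<in> sumsets E \<longleftrightarrow> x = 0 \<or> a \<le> x \<and> x \<le> t * D"
proof (induction t arbitrary: x)
  case 0
  then show ?case using a by (auto simp: sumsets_0)
next
  case (Suc t)
  have "\<exists>e\<in>E. e \<le> x \<and> (x - e = 0 \<or> a \<le> x - e \<and> x - e \<le> t * D)" if "a \<le> x" "x \<le> D + t * D"
  proof -
    consider "x \<le> D" | "x \<ge> D + a" | "D < x" "x < D + a" by linarith
    then show ?thesis
    proof cases
      case 1 then show ?thesis using that by (intro bexI[of _ x]) (auto simp: E)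
    next
      case 2 then show ?thesis using that D by (intro bexI[of _ D]) (auto simp: E)
    next
      \<comment> \<open>Removing \<open>D\<close> would leave a number strictly between 0 and
        \<open>a\<close>, which is no sum. Removing \<open>a\<close> leaves more than
        \<open>D - a\<close>, hence at least \<open>a\<close>.\<close>
      case 3 
      then have "t > 0" using that by (cases t) auto
      then have "D \<le> t * D" by simp
      with 3 have "x - a \<le> t * D" by linarith
      with 3 show ?thesis using D by (intro bexI[of _ a]) (auto simp: E)
    qed
  qed
  moreover have "a \<le> x \<and> x \<le> D + t * D"
    if "e \<in> E" "e \<le> x" "x - e = 0 \<or> a \<le> x - e \<and> x - e \<le> t * D" "x \<noteq> 0" for e
    using that D by (auto simp: E)
  ultimately show ?case unfolding sumsets_Suc Suc by (auto simp: E)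
qed

lemma translates_interval:
  "(x, Suc t) \<in> translates E W \<longleftrightarrow> (\<exists>e\<in>W. e \<le> x \<and> (x - e = 0 \<or> a \<le> x - e \<and> x - e \<le> t * D))"
  by (simp add: translates_iff sumsets_interval)

text \<open>The same choice as for the sums themselves: remove 0, or \<open>D\<close>, or else
  \<open>a\<close> when the rest would fall into the gap below \<open>a\<close>. Colons of ideals
  containing these three variables are therefore decided in degree 0.\<close>

lemma translates_degree_ge_2:
  assumes W: "{0, D, a} \<subseteq> W" and x: "(x, Suc (Suc t)) \<in> sumsets E"
  shows "(x, Suc (Suc t)) \<in> translates E W"
proof -
  from x have x: "x = 0 \<or> a \<le> x \<and> x \<le> D + D + t * D" by (auto simp: sumsets_interval)
  consider "x \<le> D + t * D" | "x > D + t * D" "x \<ge> D + a" | "x > D + t * D" "x < D + a" by linarith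
  then show ?thesis
  proof cases
    case 1 then show ?thesis unfolding translates_interval using W x by (intro bexI[of _ 0]) auto
  next
    case 2 then show ?thesis unfolding translates_interval using W x by (intro bexI[of _ D]) auto
  next
    case 3 then show ?thesis unfolding translates_interval using W x D by (intro bexI[of _ a]) auto
  qed
qed

text \<open>The equation between prefixes admits \<open>[]\<close>, \<open>[0]\<close>,
  \<open>[0, D]\<close> and every duplicate-free continuation of \<open>[0, D, a]\<close> inside
  \<open>E\<close>. The order of the first three matters, the order of the others does not.\<close>

definition filtration_lists :: "nat list set" where
  "filtration_lists = {es. distinct es \<and> set es \<subseteq> E \<and> take 3 es = take (length es) [0, D, a]}"

text \<open>The successive colons are 0 for \<open>x_0\<close>, \<open>(x_0)\<close> for
  \<open>x_D\<close>, the ideal of the variables with index 0, \<open>D\<close> or in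
  \<open>{a..D - a}\<close> for \<open>x_a\<close>, and the whole irrelevant ideal for any later
  variable.\<close>

lemma filtration_colon:
  assumes es: "es \<in> filtration_lists" and l: "l < length es"
  shows "\<exists>es'\<in>filtration_lists.
    {s \<in> sumsets E. s + (es ! l, 1) \<in> translates E (set (take l es))} = translates E (set es')"
proof -
  from es have dist: "distinct es" and sub: "set es \<subseteq> E" and pre: "take 3 es = take (length es) [0, D, a]"
    by (auto simp: filtration_lists_def)
  have nth: "es ! k = [0, D, a] ! k" if "k < 3" "k < length es" for k
    using that pre by (metis nth_take)
  have take: "take k es = take k [0, D, a]" if "k \<le> 3" "k \<le> length es" for k
    using that pre by (metis min.absorb1 take_take)
  have aD: "a < D" using a D by simp
  consider "l = 0" | "l = 1" | "l = 2" | "l \<ge> 3" by linarith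
  then show ?thesis
  proof cases
    case 1
    then have "{s \<in> sumsets E. s + (es ! l, 1) \<in> translates E (set (take l es))} = translates E (set [])"
      by (auto simp: translates_def)
    moreover have "[] \<in> filtration_lists" by (simp add: filtration_lists_def)
    ultimately show ?thesis by blast
  next
    case 2
    have *: "es ! l = D" "take l es = [0]" using 2 l nth[of 1] take[of 1] by auto
    have "(x, t) \<in> sumsets E \<and> (x + D, t + 1) \<in> translates E {0} \<longleftrightarrow> (x, t) \<in> translates E {0}" for x t
    proof (cases t)
      case 0
      then show ?thesis using a D aD by (auto simp: translates_iff sumsets_interval)
    next
      case (Suc t')
      then show ?thesis using a D aD by (auto simp: translates_iff sumsets_interval)
    qed
    then have "{s \<in> sumsets E. s + (es ! l, 1) \<in> translates E (set (take l es))} = translates E (set [0])"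
      unfolding * by (intro colon_translatesI) simp
    moreover have "[0] \<in> filtration_lists" unfolding filtration_lists_def unfolding E by simp
    ultimately show ?thesis by blast
  next
    case 3
    have *: "es ! l = a" "take l es = [0, D]" using 3 l nth[of 2] take[of 2] by auto
    \<comment> \<open>In degree 1, \<open>x + a\<close> must be an element of \<open>E\<close> or
      \<open>D\<close> plus an element of \<open>E\<close>; this leaves 0, \<open>D\<close> and the
      interval from \<open>a\<close> to \<open>D - a\<close>. It contains \<open>a\<close> because
      \<open>2 * a <= D\<close>. From degree 2 on, both sides are everything.\<close>
    define es' where "es' = 0 # D # a # [a + 1..<Suc (D - a)]"
    have set: "set es' = {0, D} \<union> {a..D - a}" using a D by (auto simp: es'_def)
    have "(x, t) \<in> sumsets E \<and> (x + a, t + 1) \<in> translates E {0, D} \<longleftrightarrow> (x, t) \<in> translates E (set es')" for x t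
    proof -
      consider "t = 0" | "t = 1" | t' where "t = Suc (Suc t')" by (metis One_nat_def old.nat.exhaust)
      then show ?thesis
      proof cases
        case 1
        then show ?thesis using a D aD by (auto simp: translates_iff sumsets_interval)
      next
        case 2
        have "(x, 1) \<in> translates E (set es') \<longleftrightarrow> x \<in> set es'"
          using a by (auto simp: translates_interval)
        moreover have "(x, 1) \<in> sumsets E \<and> (x + a, 2) \<in> translates E {0, D} \<longleftrightarrow> x \<in> set es'"
          unfolding numeral_2_eq_2 translates_interval sumsets_interval set using a D by auto
        ultimately show ?thesis using 2 by (simp add: numeral_2_eq_2)
      next
        case (3 t')
        have "(x, t) \<in> translates E (set es') \<longleftrightarrow> (x, t) \<in> sumsets E"
        proof
          assume "(x, t) \<in> sumsets E"
          moreover have "{0, D, a} \<subseteq> set es'" using D by (auto simp: set)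
          ultimately show "(x, t) \<in> translates E (set es')"
            unfolding 3 by (intro translates_degree_ge_2)
        next
          assume "(x, t) \<in> translates E (set es')"
          moreover have "set es' \<subseteq> E" using a D by (auto simp: set E)
          ultimately show "(x, t) \<in> sumsets E"
            using translates_subset by blast
        qed
        moreover have "(x + a, t + 1) \<in> translates E {0, D}" if "(x, t) \<in> sumsets E"
          using that a D unfolding 3 Suc_eq_plus1[symmetric] translates_interval sumsets_interval by auto
        ultimately show ?thesis by blast
      qed
    qed
    then have "{s \<in> sumsets E. s + (es ! l, 1) \<in> translates E (set (take l es))} = translates E (set es')"
      unfolding * by (intro colon_translatesI) simp
    moreover have "es' \<in> filtration_lists"
      using a D aD unfolding filtration_lists_def unfolding es'_def E by auto
    ultimately show ?thesis by blast
  next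
    case 4
    define es' where "es' = 0 # D # a # [a + 1..<D]"
    have set: "set es' = E" using a aD by (auto simp: es'_def E)
    let ?W = "set (take l es)"
    have "take 3 es = take 3 (take l es)" using 4 by simp
    then have W: "{0, D, a} \<subseteq> ?W" using take[of 3] 4 l set_take_subset[of 3 "take l es"] by auto
    \<comment> \<open>A new variable is not in the ideal of the earlier ones, so 1 is not in the
      colon; positive degrees are covered by \<open>translates_degree_ge_2\<close>.\<close>
    have z: "es ! l \<notin> ?W" "es ! l \<in> E" using dist l subsetD[OF sub nth_mem[OF l]] by (auto simp: in_set_conv_nth nth_eq_iff_index_eq)
    have "(x, t) \<in> sumsets E \<and> (x + es ! l, t + 1) \<in> translates E ?W \<longleftrightarrow> (x, t) \<in> translates E (set es')" for x t
    proof (cases t)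
      case 0
      then show ?thesis using z by (auto simp: translates_iff sumsets_0)
    next
      case (Suc t')
      have "(x + es ! l, Suc (Suc t')) \<in> translates E ?W" if "(x, t) \<in> sumsets E"
        using add_sumsets[OF that single_mem_sumsets[OF z(2)]] Suc
        by (intro translates_degree_ge_2 W) simp
      moreover have "(x, t) \<in> translates E E \<longleftrightarrow> (x, t) \<in> sumsets E"
        unfolding Suc translates_iff sumsets_Suc by simp
      ultimately show ?thesis using Suc set by auto
    qed
    then have "{s \<in> sumsets E. s + (es ! l, 1) \<in> translates E ?W} = translates E (set es')"
      by (rule colon_translatesI)
    moreover have "es' \<in> filtration_lists"
      using a D aD unfolding filtration_lists_def unfolding es'_def E by auto
    ultimately show ?thesis by blast
  qed
qed

lemma koszul_algebra_interval:
  fixes R :: "'a ring" and \<phi> :: "'a \<Rightarrow> nat \<times> nat \<Rightarrow>\<^sub>0 'k::comm_ring_1"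
  assumes "cring R" "bij_betw \<phi> (carrier R) (supported (sumsets E))"
    "\<phi> \<one>\<^bsub>R\<^esub> = 1"
    "\<And>x y. x \<in> carrier R \<Longrightarrow> y \<in> carrier R \<Longrightarrow> \<phi> (x \<oplus>\<^bsub>R\<^esub> y) = \<phi> x + \<phi> y"
    "\<And>x y. x \<in> carrier R \<Longrightarrow> y \<in> carrier R \<Longrightarrow> \<phi> (x \<otimes>\<^bsub>R\<^esub> y) = \<phi> x * \<phi> y"
    "\<And>t. G t \<subseteq> carrier R" "\<And>t. \<phi> ` G t = homogeneous (sumsets E) t"
  shows "koszul_algebra R G"
proof -
  define es where "es = 0 # D # a # [a + 1..<D]"
  have es: "set es = E" "es \<in> filtration_lists"
    using a D unfolding filtration_lists_def unfolding es_def E by auto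
  interpret F: koszul_filtration "supported (sumsets E) :: (_ \<Rightarrow>\<^sub>0 'k) set" "homogeneous (sumsets E)"
      component "map gen ` filtration_lists"
    by (rule koszul_filtration_gen[OF _ filtration_colon]) (auto simp: filtration_lists_def)
  interpret R: graded_ring_iso "supported (sumsets E) :: (_ \<Rightarrow>\<^sub>0 'k) set" "homogeneous (sumsets E)"
      component R G \<phi> "map gen es"
    by (rule graded_ring_iso_gen[OF es(1) assms])
  obtain gss where "F.vspan (gss 0) = {c. c 0 \<in> F.ideal_span (map gen es) \<and> (\<forall>j>0. c j = 0)}"
    "\<And>i. F.vspan (gss (Suc i)) = F.syz (gss i)"
    "\<And>i g j. g \<in> set (gss i) \<Longrightarrow> g j \<in> homogeneous (sumsets E) 1"
    using F.linear_syzygies[of "map gen es"] es(2) by blast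
  then show ?thesis by (rule R.koszul_algebraI)
qed

end

section \<open>The necessary condition\<close>

text \<open>The relation that the quadratic binomials of the toric ideal induce on monomials, which are
  written as multisets of exponents.\<close>

inductive quad_conn :: "nat set \<Rightarrow> nat multiset \<Rightarrow> nat multiset \<Rightarrow> bool" for E where
  refl: "quad_conn E w w"
| step: "quad_conn E w (add_mset i (add_mset j v)) \<Longrightarrow> i + j = k + l \<Longrightarrow> {i, j, k, l} \<subseteq> E \<Longrightarrow>
    quad_conn E w (add_mset k (add_mset l v))"

lemma quad_conn_trans:
  assumes "quad_conn E u v" "quad_conn E v w"
  shows "quad_conn E u w"
  using assms(2,1) by (induction rule: quad_conn.induct) (auto intro: quad_conn.intros)

lemma quad_conn_add: "quad_conn E v w \<Longrightarrow> quad_conn E (add_mset e v) (add_mset e w)"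
proof (induction rule: quad_conn.induct)
  case (step w i j v k l)
  then show ?case
    using quad_conn.step[of E "add_mset e w" i j "add_mset e v" k l] by (simp add: add_mset_commute)
qed (rule quad_conn.refl)

lemma extend_lin_scale:
  "extend_lin f (single 0 c * p) = c * extend_lin f p" for p :: "'a::comm_monoid_add \<Rightarrow>\<^sub>0 'k::comm_ring_1"
  by (induction p rule: poly_mapping_single_induct) (auto simp: distrib_left mult_single mult.assoc)

lemma lookup_scale:
  "lookup (single 0 c * p) s = c * lookup p s" for p :: "'a::comm_monoid_add \<Rightarrow>\<^sub>0 'k::comm_ring_1"
  by (induction p rule: poly_mapping_single_induct)
    (auto simp: distrib_left mult_single lookup_add lookup_single when_def)

lemma homogeneous_0:
  assumes "p \<in> homogeneous (sumsets E) 0"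
  shows "p = single 0 (lookup p 0)"
proof (rule poly_mapping_eqI)
  fix s
  have "s = 0" if "s \<in> keys p"
  proof -
    have "s \<in> sumsets E" "snd s = 0" using assms that by (auto simp: homogeneous_def)
    then show ?thesis by (cases s) (auto simp: sumsets_0 zero_prod_def)
  qed
  then show "lookup p s = lookup (single 0 (lookup p 0)) s"
    by (auto simp: lookup_single when_def in_keys_iff)
qed

lemma homogeneous_1:
  assumes "finite E" "p \<in> homogeneous (sumsets E) 1"
  shows "p = (\<Sum>e\<in>E. single (e, 1) (lookup p (e, 1)))"
proof (rule poly_mapping_eqI)
  fix s
  have key: "snd s = 1 \<and> fst s \<in> E" if "s \<in> keys p"
  proof -
    have "s \<in> sumsets E" "snd s = 1" using assms that by (auto simp: homogeneous_def)
    then show ?thesis using sumsets_Suc[of "fst s" 0 E] by (cases s) (auto simp: sumsets_0)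
  qed
  have "lookup (\<Sum>e\<in>E. single (e, 1) (lookup p (e, 1))) s =
      (\<Sum>e\<in>E. if (e, 1) = s then lookup p s else 0)"
    unfolding lookup_sum by (intro sum.cong) (auto simp: lookup_single when_def)
  also have "\<dots> = lookup p s"
  proof (cases "s \<in> keys p")
    case True
    then have "((e, 1) = s) = (e = fst s)" for e using key by (cases s) auto
    then show ?thesis using True key assms(1) by simp
  next
    case False
    then show ?thesis by (auto simp: in_keys_iff intro: sum.neutral)
  qed
  finally show "lookup p s = lookup (\<Sum>e\<in>E. single (e, 1) (lookup p (e, 1))) s" by simp
qed

text \<open>Induction on the number of factors. Splitting one factor off \<open>w\<close> and one
  off \<open>w'\<close> gives a syzygy of two variables; it is a combination of linear syzygies, and
  a functional that vanishes on those transfers the property of being connected to \<open>w\<close>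
  from one factorization to the other.\<close>

theorem koszul_quad_conn:
  fixes R :: "'a ring" and \<phi> :: "'a \<Rightarrow> nat \<times> nat \<Rightarrow>\<^sub>0 'k::comm_ring_1"
  assumes koszul: "koszul_algebra R G"
    and es: "set es = E"
    and iso: "cring R" "bij_betw \<phi> (carrier R) (supported (sumsets E))"
    "\<phi> \<one>\<^bsub>R\<^esub> = 1"
    "\<And>x y. x \<in> carrier R \<Longrightarrow> y \<in> carrier R \<Longrightarrow> \<phi> (x \<oplus>\<^bsub>R\<^esub> y) = \<phi> x + \<phi> y"
    "\<And>x y. x \<in> carrier R \<Longrightarrow> y \<in> carrier R \<Longrightarrow> \<phi> (x \<otimes>\<^bsub>R\<^esub> y) = \<phi> x * \<phi> y"
    "\<And>t. G t \<subseteq> carrier R" "\<And>t. \<phi> ` G t = homogeneous (sumsets E) t"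
    and w: "set_mset w \<subseteq> E" "set_mset w' \<subseteq> E" "size w = size w'" "sum_mset w = sum_mset w'"
  shows "quad_conn E w w'"
proof -
  interpret R: graded_ring_iso "supported (sumsets E) :: (_ \<Rightarrow>\<^sub>0 'k) set" "homogeneous (sumsets E)"
      component R G \<phi> "map gen es"
    by (rule graded_ring_iso_gen[OF es iso])
  have fin: "finite E" using es by auto
  obtain b0 b1 b2 :: nat and Y Z :: "nat \<Rightarrow> nat \<Rightarrow> _ \<Rightarrow>\<^sub>0 'k" where b0: "b0 > 0"
    and Y: "\<And>k j. k < b1 \<Longrightarrow> j < b0 \<Longrightarrow> Y k j \<in> homogeneous (sumsets E) 1"
    and Z: "\<And>l k. l < b2 \<Longrightarrow> k < b1 \<Longrightarrow> Z l k \<in> homogeneous (sumsets E) 1"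
    and ZY: "\<And>l j. l < b2 \<Longrightarrow> j < b0 \<Longrightarrow> (\<Sum>k<b1. Z l k * Y k j) = 0"
    and syz: "\<And>a. (\<And>k. k < b1 \<Longrightarrow> a k \<in> supported (sumsets E)) \<Longrightarrow>
      (\<And>j. j < b0 \<Longrightarrow> (\<Sum>k<b1. a k * Y k j) = 0) \<Longrightarrow>
      \<exists>c. (\<forall>l<b2. c l \<in> supported (sumsets E)) \<and> (\<forall>k<b1. a k = (\<Sum>l<b2. c l * Z l k))"
    and gens: "\<And>x. x \<in> homogeneous (sumsets E) 1 \<Longrightarrow> \<exists>z. (\<forall>k<b1. z k \<in> homogeneous (sumsets E) 0) \<and>
      (\<forall>j<b0. (\<Sum>k<b1. z k * Y k j) = (if j = 0 then x else 0))"
    by (rule R.koszul_algebraD[OF koszul]) blast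
  define \<eta> where "\<eta> k i = lookup (Y k 0) (i, 1)" for k i
  define \<sigma> where "\<sigma> l k j = lookup (Z l k) (j, 1)" for l k j
  have Y_eq: "Y k 0 = (\<Sum>i\<in>E. single (i, 1) (\<eta> k i))" if "k < b1" for k
    unfolding \<eta>_def using homogeneous_1[OF fin Y[OF that b0]] .
  have Z_eq: "Z l k = (\<Sum>j\<in>E. single (j, 1) (\<sigma> l k j))" if "l < b2" "k < b1" for l k
    unfolding \<sigma>_def using homogeneous_1[OF fin Z[OF that]] .
  have "quad_conn E w w'"
    if "set_mset w \<subseteq> E" "set_mset w' \<subseteq> E" "size w = t" "size w' = t" "sum_mset w = sum_mset w'" for t w w'
    using that
  proof (induction t arbitrary: w w')
    case 0
    then show ?case by (auto intro: quad_conn.refl)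
  next
    case (Suc t)
    obtain i u where u: "w = add_mset i u" using Suc.prems(3) by (metis size_eq_Suc_imp_eq_union)
    obtain j u' where u': "w' = add_mset j u'" using Suc.prems(4) by (metis size_eq_Suc_imp_eq_union)
    have size: "size u = t" "size u' = t" and E: "set_mset u \<subseteq> E" "set_mset u' \<subseteq> E" "i \<in> E" "j \<in> E"
      and sum: "i + sum_mset u = j + sum_mset u'"
      using Suc.prems by (auto simp: u u')
    define \<chi> :: "nat \<Rightarrow> nat \<times> nat \<Rightarrow> 'k" where "\<chi> e s = (if \<exists>v. set_mset v \<subseteq> E \<and> size v = t \<and>
      s = (sum_mset v, t) \<and> quad_conn E w (add_mset e v) then 1 else 0)" for e s
    \<comment> \<open>\<open>\<Lambda>\<close> vanishes on the multiples of linear syzygies, since these only compare factorizations that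
      differ by a quadratic exchange, but not on the syzygy given by \<open>w\<close> and \<open>w'\<close> if these are not
      connected.\<close>
    define \<Lambda> where "\<Lambda> a = (\<Sum>k<b1. \<Sum>e\<in>E. \<eta> k e * extend_lin (\<chi> e) (a k))"
      for a :: "nat \<Rightarrow> nat \<times> nat \<Rightarrow>\<^sub>0 'k"
    \<comment> \<open>The pair \<open>s\<close> only remembers the sum of \<open>v\<close>. By the
      induction hypothesis all factorizations of \<open>s\<close> into \<open>t\<close> variables
      are connected, so the choice of \<open>v\<close> is immaterial.\<close>
    have \<chi>_eq: "\<chi> e (sum_mset v, t) = (if quad_conn E w (add_mset e v) then 1 else 0)"
      if v: "set_mset v \<subseteq> E" "size v = t" for e v
    proof -
      have "quad_conn E w (add_mset e v)"
        if "set_mset v' \<subseteq> E" "size v' = t" "sum_mset v' = sum_mset v" "quad_conn E w (add_mset e v')" for v'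
        using quad_conn_trans[OF that(4) quad_conn_add[OF Suc.IH[of v' v]]] that v by simp
      with v show ?thesis unfolding \<chi>_def by auto
    qed
    have zero: "\<Lambda> (\<lambda>k. single s 1 * Z l k) = 0" if l: "l < b2" and s: "s \<in> sumsets E" for l s
    proof -
      obtain v where v: "set_mset v \<subseteq> E" "s = (sum_mset v, size v)"
        using s by (auto simp: sumsets_def)
      \<comment> \<open>Replacing \<open>e, f\<close> by another pair with the same sum is one
        quadratic exchange, so the value of \<open>\<chi>\<close> depends on \<open>e + f\<close>
        only. Thus \<open>\<Lambda>\<close> on a monomial multiple of a row of \<open>Z\<close> is a
        functional of the products of \<open>Z\<close> with \<open>Y\<close>, whose sum is
        zero.\<close>
      define g :: "nat \<times> nat \<Rightarrow> 'k" where
        "g x = (if \<exists>e\<in>E. \<exists>f\<in>E. x = (e + f, 2) \<and> \<chi> e (s + (f, 1)) = 1 then 1 else 0)" for x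
      have g: "g (e + f, 2) = \<chi> e (s + (f, 1))" if "e \<in> E" "f \<in> E" for e f
      proof (cases "Suc (size v) = t")
        case True
        have *: "\<chi> e (s + (f, 1)) = (if quad_conn E w (add_mset e (add_mset f v)) then 1 else 0)"
          if "f \<in> E" for e f
          using \<chi>_eq[of "add_mset f v" e] that v True by (simp add: add.commute)
        have "quad_conn E w (add_mset e (add_mset f v))"
          if "e' \<in> E" "f' \<in> E" "e' + f' = e + f" "quad_conn E w (add_mset e' (add_mset f' v))" for e' f'
          using that \<open>e \<in> E\<close> \<open>f \<in> E\<close> by (intro quad_conn.step[OF that(4)]) auto
        then show ?thesis unfolding g_def using that by (auto simp: * simp del: One_nat_def split: if_splits)
      next
        case False
        then have "\<chi> e' (s + (f', 1)) = 0" for e' f' using v by (auto simp: \<chi>_def)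
        then show ?thesis by (simp add: g_def)
      qed
      have "\<Lambda> (\<lambda>k. single s 1 * Z l k) = (\<Sum>k<b1. \<Sum>e\<in>E. \<Sum>f\<in>E. \<eta> k e * (\<sigma> l k f * \<chi> e (s + (f, 1))))"
        unfolding \<Lambda>_def using l
        by (intro sum.cong HOL.refl) (simp add: Z_eq sum_distrib_left mult_single)
      also have "\<dots> = (\<Sum>k<b1. \<Sum>e\<in>E. \<Sum>f\<in>E. \<eta> k e * (\<sigma> l k f * g (e + f, 2)))"
        by (intro sum.cong HOL.refl) (simp add: g)
      also have "\<dots> = (\<Sum>k<b1. extend_lin g (Z l k * Y k 0))"
      proof (intro sum.cong HOL.refl)
        fix k assume k: "k \<in> {..<b1}"
        have "Z l k * Y k 0 = (\<Sum>e\<in>E. \<Sum>f\<in>E. single (e + f, 2) (\<eta> k e * \<sigma> l k f))"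
          using k l by (subst mult.commute)
            (simp add: Z_eq Y_eq sum_product mult_single numeral_2_eq_2)
        then show "(\<Sum>e\<in>E. \<Sum>f\<in>E. \<eta> k e * (\<sigma> l k f * g (e + f, 2))) = extend_lin g (Z l k * Y k 0)"
          by (simp add: mult.assoc)
      qed
      also have "\<dots> = 0" using ZY[OF l b0] by (simp flip: extend_lin_sum)
      finally show ?thesis .
    qed
    have zero': "\<Lambda> (\<lambda>k. c * Z l k) = 0" if l: "l < b2" and c: "c \<in> supported (sumsets E)" for l c
    proof (induction c rule: poly_mapping_single_induct)
      case zero
      then show ?case by (simp add: \<Lambda>_def)
    next
      case (add s r q)
      have "s \<in> sumsets E" using add c by (auto simp: supported_def)
      have "single s r = single 0 r * single s 1" by (simp add: mult_single)
      then have "\<Lambda> (\<lambda>k. (single s r + q) * Z l k) = r * \<Lambda> (\<lambda>k. single s 1 * Z l k) + \<Lambda> (\<lambda>k. q * Z l k)"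
        unfolding \<Lambda>_def
        by (simp add: distrib_right distrib_left sum.distrib sum_distrib_left mult.assoc extend_lin_scale mult.left_commute)
      then show ?case using add.IH zero[OF l \<open>s \<in> sumsets E\<close>] by simp
    qed
    \<comment> \<open>Constants that express the variable \<open>e\<close> through the rows of
      \<open>Y\<close>. By \<open>dual\<close>, they form a left inverse of the coefficient matrix
      \<open>\<eta>\<close>.\<close>
    have "\<exists>\<zeta>. \<forall>j<b0. (\<Sum>k<b1. single 0 (\<zeta> k) * Y k j) = (if j = 0 then gen e else 0)" if e: "e \<in> E" for e
    proof -
      obtain z where z: "\<forall>k<b1. z k \<in> homogeneous (sumsets E) 0"
        "\<forall>j<b0. (\<Sum>k<b1. z k * Y k j) = (if j = 0 then gen e else 0)"
        using gens[OF gen_homogeneous[OF e]] by blast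
      have "single 0 (lookup (z k) 0) = z k" if "k < b1" for k
        using z(1) that homogeneous_0[of "z k" E] by simp
      with z(2) show ?thesis by (intro exI[of _ "\<lambda>k. lookup (z k) 0"]) simp
    qed
    then obtain \<zeta> where \<zeta>: "\<And>e j. e \<in> E \<Longrightarrow> j < b0 \<Longrightarrow>
        (\<Sum>k<b1. single 0 (\<zeta> e k) * Y k j) = (if j = 0 then gen e else 0)"
      by metis
    have dual: "(\<Sum>k<b1. \<zeta> e k * \<eta> k f) = (if e = f then 1 else 0)" if "e \<in> E" for e f
    proof -
      have "(\<Sum>k<b1. \<zeta> e k * \<eta> k f) = lookup (\<Sum>k<b1. single 0 (\<zeta> e k) * Y k 0) (f, 1)"
        by (simp add: lookup_sum lookup_scale \<eta>_def)
      also have "\<dots> = (if e = f then 1 else 0)"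
        unfolding \<zeta>[OF that b0] by (simp add: gen_def lookup_single when_def)
      finally show ?thesis .
    qed
    \<comment> \<open>The relation between the variables \<open>i\<close> and \<open>j\<close> with
      monomial coefficients \<open>u\<close> and \<open>u'\<close>, rewritten as a syzygy of the
      rows of \<open>Y\<close>.\<close>
    define a where "a k = single 0 (\<zeta> i k) * single (sum_mset u, t) 1 - single 0 (\<zeta> j k) * single (sum_mset u', t) 1" for k
    have mem: "(sum_mset u, t) \<in> sumsets E" "(sum_mset u', t) \<in> sumsets E"
      using E size by (auto simp: sumsets_def)
    have "a k \<in> supported (sumsets E)" for k
    proof -
      have "keys (a k) \<subseteq> {(sum_mset u, t), (sum_mset u', t)}"
        unfolding a_def mult_single by (rule order.trans[OF keys_diff]) auto
      with mem show ?thesis unfolding supported_def by blast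
    qed
    moreover have "(\<Sum>k<b1. a k * Y k j') = 0" if "j' < b0" for j'
    proof -
      have "(\<Sum>k<b1. a k * Y k j') = single (sum_mset u, t) 1 * (\<Sum>k<b1. single 0 (\<zeta> i k) * Y k j') -
          single (sum_mset u', t) 1 * (\<Sum>k<b1. single 0 (\<zeta> j k) * Y k j')"
        unfolding a_def by (simp only: left_diff_distrib sum_subtractf sum_distrib_left mult.assoc mult.left_commute)
      also have "\<dots> = 0"
        using sum that by (auto simp: \<zeta>[OF E(3) that] \<zeta>[OF E(4) that] gen_def mult_single add.commute)
      finally show ?thesis .
    qed
    ultimately obtain c where c: "\<forall>l<b2. c l \<in> supported (sumsets E)" "\<forall>k<b1. a k = (\<Sum>l<b2. c l * Z l k)"
      using syz[of a] by auto
    have "\<Lambda> a = (\<Sum>l<b2. \<Lambda> (\<lambda>k. c l * Z l k))"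
    proof -
      have "\<Lambda> a = (\<Sum>k<b1. \<Sum>e\<in>E. \<Sum>l<b2. \<eta> k e * extend_lin (\<chi> e) (c l * Z l k))"
        unfolding \<Lambda>_def using c(2) by (intro sum.cong HOL.refl) (simp add: sum_distrib_left)
      also have "\<dots> = (\<Sum>k<b1. \<Sum>l<b2. \<Sum>e\<in>E. \<eta> k e * extend_lin (\<chi> e) (c l * Z l k))"
        by (intro sum.cong HOL.refl sum.swap)
      also have "\<dots> = (\<Sum>l<b2. \<Lambda> (\<lambda>k. c l * Z l k))"
        unfolding \<Lambda>_def by (rule sum.swap)
      finally show ?thesis .
    qed
    also have "\<dots> = 0" using zero' c(1) by (intro sum.neutral) auto
    finally have "\<Lambda> a = 0" .
    \<comment> \<open>By \<open>dual\<close> the constants cancel and only the two given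
      factorizations are tested.\<close>
    moreover have "\<Lambda> a = \<chi> i (sum_mset u, t) - \<chi> j (sum_mset u', t)"
    proof -
      have "extend_lin (\<chi> e) (a k) = \<zeta> i k * \<chi> e (sum_mset u, t) - \<zeta> j k * \<chi> e (sum_mset u', t)" for e k
        unfolding a_def mult_single diff_conv_add_uminus by (simp del: add_uminus_conv_diff)
      note lin = this
      have "\<Lambda> a = (\<Sum>k<b1. \<Sum>e\<in>E. (\<zeta> i k * \<eta> k e) * \<chi> e (sum_mset u, t) - (\<zeta> j k * \<eta> k e) * \<chi> e (sum_mset u', t))"
        unfolding \<Lambda>_def lin by (simp add: algebra_simps)
      also have "\<dots> = (\<Sum>e\<in>E. (\<Sum>k<b1. \<zeta> i k * \<eta> k e) * \<chi> e (sum_mset u, t) - (\<Sum>k<b1. \<zeta> j k * \<eta> k e) * \<chi> e (sum_mset u', t))"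
        by (subst sum.swap) (simp add: sum_subtractf sum_distrib_right)
      also have "\<dots> = (\<Sum>e\<in>E. (if e = i then \<chi> e (sum_mset u, t) else 0) - (if e = j then \<chi> e (sum_mset u', t) else 0))"
        by (intro sum.cong HOL.refl) (auto simp: dual E)
      also have "\<dots> = \<chi> i (sum_mset u, t) - \<chi> j (sum_mset u', t)"
        using fin E by (simp add: sum_subtractf)
      finally show ?thesis .
    qed
    moreover have "\<chi> i (sum_mset u, t) = 1"
      using \<chi>_eq[OF E(1) size(1), of i] quad_conn.refl[of E w] by (simp add: u)
    ultimately have "\<chi> j (sum_mset u', t) = 1" by simp
    then show ?case
      using \<chi>_eq[OF E(2) size(2), of j] by (auto simp: u' split: if_splits)
  qed
  with w show ?thesis by metis
qed

section \<open>Quadratic connectedness of generalized arithmetic sequences\<close>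

definition quadratically_connected :: "nat set \<Rightarrow> bool" where
  "quadratically_connected E \<longleftrightarrow> (\<forall>w w'. set_mset w \<subseteq> E \<longrightarrow> set_mset w' \<subseteq> E \<longrightarrow>
     size w = size w' \<longrightarrow> sum_mset w = sum_mset w' \<longrightarrow> quad_conn E w w')"

lemma quad_conn_invariant:
  assumes "quad_conn E w w'" "P w"
    and "\<And>i j k l v. {i, j, k, l} \<subseteq> E \<Longrightarrow> i + j = k + l \<Longrightarrow> P (add_mset i (add_mset j v)) \<Longrightarrow>
      P (add_mset k (add_mset l v))"
  shows "P w'"
  using assms(1,2) by (induction rule: quad_conn.induct) (auto intro: assms(3))

lemma sum_mset_replicate: "sum_mset (replicate_mset k (x::nat)) = k * x"
  by (induction k) auto

text \<open>Without a relation \<open>x = y + z\<close> the multiplicity of 0 is invariant under quadratic exchanges,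
  whereas it differs for the two factorizations in \<open>D \<cdot> a = a \<cdot> D + (D - a) \<cdot> 0\<close>.\<close>

lemma quadratically_connected_imp_sum:
  assumes conn: "quadratically_connected E" and E: "0 \<in> E" "a \<in> E" "D \<in> E" and a: "0 < a" "a < D"
  shows "\<exists>x\<in>E. \<exists>y\<in>E. \<exists>z\<in>E. 0 < y \<and> 0 < z \<and> x = y + z"
proof (rule ccontr)
  assume none: "\<not> ?thesis"
  let ?w = "replicate_mset D a" and ?w' = "replicate_mset a D + replicate_mset (D - a) 0"
  have "quad_conn E ?w ?w'"
    using conn E a unfolding quadratically_connected_def
    by (auto simp: sum_mset_replicate split: if_splits)
  then have "count ?w' 0 = 0"
  proof (rule quad_conn_invariant)
    fix i j k l v
    assume *: "{i, j, k, l} \<subseteq> E" "i + j = k + l" "count (add_mset i (add_mset j v)) 0 = 0"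
    then have "0 < i" "0 < j" "count v 0 = 0" by (auto split: if_splits)
    \<comment> \<open>If \<open>k\<close> were 0, then \<open>l\<close> would be the sum of the two
      positive elements \<open>i\<close> and \<open>j\<close>, and likewise with \<open>k\<close>
      and \<open>l\<close> interchanged.\<close>
    with * none have "0 < k" "0 < l" by (metis add_0 add_0_right insert_subset not_gr_zero)+
    with \<open>count v 0 = 0\<close> show "count (add_mset k (add_mset l v)) 0 = 0" by simp
  qed (use a in \<open>auto simp: count_replicate_mset\<close>)
  with a show False by (simp add: count_replicate_mset)
qed

text \<open>All exchanges starting at \<open>w\<close> are trivial, so its connected component is a
  single multiset.\<close>

lemma quadratically_connected_isolated:
  assumes conn: "quadratically_connected E" and w: "set_mset w \<subseteq> E" "set_mset w' \<subseteq> E"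
    "size w = size w'" "sum_mset w = sum_mset w'"
    and isolated: "\<And>i j k l v. w = add_mset i (add_mset j v) \<Longrightarrow> k \<in> E \<Longrightarrow> l \<in> E \<Longrightarrow> i + j = k + l \<Longrightarrow>
      {#k, l#} = {#i, j#}"
  shows "w' = w"
proof (rule quad_conn_invariant[of E w w'])
  show "quad_conn E w w'" using conn w unfolding quadratically_connected_def by blast
  fix i j k l v
  assume *: "{i, j, k, l} \<subseteq> E" "i + j = k + l" "add_mset i (add_mset j v) = w"
  then have "{#k, l#} = {#i, j#}" by (intro isolated) auto
  then have "{#k, l#} + v = {#i, j#} + v" by simp
  then show "add_mset k (add_mset l v) = w" using *(3) by simp
qed simp

text \<open>For \<open>h >= 2\<close> the next element after \<open>a\<close> exceeds
  \<open>2 * a\<close>, so \<open>a + a\<close> admits no exchange; isolated multisets made of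
  copies of \<open>a\<close>, with at most one other element, then contradict connectedness. For
  \<open>h = 1\<close> the relation \<open>x = y + z\<close> determines \<open>d\<close> and bounds
  \<open>a\<close>.\<close>

lemma quadratically_connected_arithmetic:
  fixes a h d n :: nat
  assumes n: "n \<ge> 2" and a: "a > 0" and h: "h > 0" and d: "d > 0" and gcd: "gcd a d = 1"
    and E: "E = {0, a} \<union> (\<lambda>i. h * a + (i - 1) * d) ` {2..n}"
    and conn: "quadratically_connected E"
  shows "h = 1 \<and> d = 1 \<and> n > a"
proof -
  have E_cases: "x = 0 \<or> x = a \<or> (\<exists>i. 2 \<le> i \<and> i \<le> n \<and> x = h * a + (i - 1) * d)" if "x \<in> E" for x
    using that unfolding E by auto
  have E_mem: "h * a + (i - 1) * d \<in> E" if "2 \<le> i" "i \<le> n" for i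
    using that unfolding E by auto
  have E0: "0 \<in> E" "a \<in> E" unfolding E by auto
  have big: "d \<le> (i - 1) * d" if "2 \<le> i" for i
    using that by (cases "i - 1") auto
  have E_ge: "x = 0 \<or> x = a \<or> h * a + d \<le> x" if "x \<in> E" for x
    using E_cases[OF that]
  proof (elim disjE exE conjE)
    fix i assume "2 \<le> i" "x = h * a + (i - 1) * d"
    with big[of i] show ?thesis by linarith
  qed simp_all
  have ha: "a \<le> h * a" using h by simp
  have dvd: "d = 1" if "d dvd a" using that gcd by (metis gcd.commute gcd_nat.absorb1)
  have "h * a + (n - 1) * d \<in> E" using E_mem n by auto
  moreover have "a < h * a + (n - 1) * d" using ha big[OF n] d by linarith
  ultimately obtain x y z where xyz: "x \<in> E" "y \<in> E" "z \<in> E" "0 < y" "0 < z" "x = y + z"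
    using quadratically_connected_imp_sum[OF conn E0] a by blast
  have "h = 1"
  proof (rule ccontr)
    assume "h \<noteq> 1"
    then have "2 \<le> h" using h by simp
    then have h2: "2 * a \<le> h * a" by simp
    have pair_aa: "{#k, l#} = {#a, a#}" if "k \<in> E" "l \<in> E" "a + a = k + l" for k l
    proof -
      have "k = 0 \<or> k = a" "l = 0 \<or> l = a"
        using E_ge[OF that(1)] E_ge[OF that(2)] that(3) h2 d by linarith+
      with that(3) a show ?thesis by auto
    qed
    show False
    proof (cases "d = 1 \<and> n > a")
      case True
      let ?w = "replicate_mset (Suc h) a" and ?w' = "add_mset ((h + 1) * a) (replicate_mset h 0)"
      \<comment> \<open>With \<open>d = 1\<close> and \<open>n > a\<close> this is the element of
        index \<open>a + 1\<close>.\<close>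
      have "(h + 1) * a \<in> E" using E_mem[of "a + 1"] True a by (simp add: add.commute)
      then have "set_mset ?w \<subseteq> E" "set_mset ?w' \<subseteq> E" using E0 by (simp_all split: if_splits)
      moreover have "size ?w = size ?w'" "sum_mset ?w = sum_mset ?w'" by (simp_all add: sum_mset_replicate)
      moreover have "{#k, l#} = {#i, j#}"
        if "?w = add_mset i (add_mset j v)" "k \<in> E" "l \<in> E" "i + j = k + l" for i j k l v
      proof -
        have "i \<in># ?w" "j \<in># ?w" unfolding that(1) by auto
        then have "i = a" "j = a" by (auto split: if_splits)
        with that pair_aa show ?thesis by simp
      qed
      ultimately have "?w' = ?w" by (rule quadratically_connected_isolated[OF conn])
      moreover have "0 \<in># ?w'" using h by simp
      ultimately show False using a by (auto split: if_splits)
    next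
      case False
      \<comment> \<open>For \<open>n = 2\<close> the positive elements are \<open>a\<close> and
        \<open>h * a + d\<close>, which is larger than \<open>2 * a\<close>; neither is a sum of two
        of them.\<close>
      have "n \<ge> 3"
      proof (rule ccontr)
        assume "\<not> n \<ge> 3"
        with n have "n = 2" by simp
        have E3: "x = 0 \<or> x = a \<or> x = h * a + d" if "x \<in> E" for x
          using that unfolding E \<open>n = 2\<close> by (auto simp: atLeastAtMost_singleton)
        show False using E3[OF xyz(1)] E3[OF xyz(2)] E3[OF xyz(3)] xyz(4-6) h2 d a
          by (elim disjE) linarith+
      qed
      define m3 where "m3 = h * a + 2 * d"
      define m2 where "m2 = h * a + d"
      have m: "m3 \<in> E" "m2 \<in> E" using E_mem[of 3] E_mem[of 2] \<open>n \<ge> 3\<close> by (auto simp: m3_def m2_def)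
      have pair_am: "{#k, l#} = {#a, m3#}" if "k \<in> E" "l \<in> E" "a + m3 = k + l" for k l
      proof -
        \<comment> \<open>Membership would give \<open>a = (i - 3) * d\<close>, hence
          \<open>d = 1\<close> by coprimality and \<open>n > a\<close>, the case already
          treated.\<close>
        have not_0: False if "a + m3 \<in> E"
        proof -
          from E_cases[OF that] obtain i where i: "2 \<le> i" "i \<le> n" "a + 2 * d = (i - 1) * d"
            using a ha d by (auto simp: m3_def)
          then have "a = (i - 1) * d - 2 * d" by linarith
          then have eq: "a = (i - 3) * d" by (simp flip: diff_mult_distrib) (simp add: numeral_3_eq_3 numeral_2_eq_2)
          then have "d = 1" by (intro dvd) simp
          with eq i a have "n > a" by simp
          with False \<open>d = 1\<close> show False by simp
        qed
        have "k \<noteq> 0" "l \<noteq> 0" using not_0 that by (auto intro!: Nat.gr0I)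
        moreover have "k = a \<or> l = a"
        proof (rule ccontr)
          assume "\<not> (k = a \<or> l = a)"
          \<comment> \<open>Two elements beyond \<open>a\<close> add up to at least
            \<open>m3 + h * a\<close>, which exceeds \<open>m3 + a\<close>.\<close>
          then have "k + l \<ge> h * a + d + (h * a + d)"
            using E_ge[OF that(1)] E_ge[OF that(2)] \<open>k \<noteq> 0\<close> \<open>l \<noteq> 0\<close> by linarith
          with that h2 a show False by (simp add: m3_def)
        qed
        ultimately show ?thesis using that(3) by (auto simp: add_mset_commute)
      qed
      let ?w = "add_mset m3 (replicate_mset h a)"
      let ?w' = "add_mset m2 (add_mset m2 (replicate_mset (h - 1) 0))"
      have "set_mset ?w \<subseteq> E" "set_mset ?w' \<subseteq> E" using E0 m by (simp_all split: if_splits)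
      moreover have "size ?w = size ?w'" using h by simp
      moreover have "sum_mset ?w = sum_mset ?w'" by (simp add: sum_mset_replicate m2_def m3_def)
      moreover have "{#k, l#} = {#i, j#}"
        if w: "?w = add_mset i (add_mset j v)" and kl: "k \<in> E" "l \<in> E" "i + j = k + l" for i j k l v
      proof -
        have m3_a: "m3 \<noteq> a" unfolding m3_def using ha d by linarith
        have "i \<in># ?w" "j \<in># ?w" unfolding w by auto
        then have "i = m3 \<or> i = a" "j = m3 \<or> j = a" by (simp_all split: if_splits)
        moreover have "\<not> (i = m3 \<and> j = m3)"
        proof
          assume "i = m3 \<and> j = m3"
          then have "count ?w m3 \<ge> 2" unfolding w by simp
          then show False using m3_a by (simp add: count_replicate_mset)
        qed
        ultimately consider "i = a" "j = a" | "i = a" "j = m3" | "i = m3" "j = a" by blast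
        then show ?thesis
          using pair_aa pair_am kl by cases (simp_all add: add.commute add_mset_commute)
      qed
      ultimately have "?w' = ?w" by (rule quadratically_connected_isolated[OF conn])
      moreover have "0 \<in># ?w'" using \<open>2 \<le> h\<close> by simp
      ultimately show False using a d by (auto simp: m3_def split: if_splits)
    qed
  qed
  have form: "\<exists>i. 1 \<le> i \<and> i \<le> n \<and> x = a + (i - 1) * d" if "x \<in> E" "x > 0" for x
  proof -
    from E_cases[OF that(1)] that(2) consider "x = a" | i where "2 \<le> i" "i \<le> n" "x = a + (i - 1) * d"
      using \<open>h = 1\<close> by auto
    then show ?thesis
    proof cases
      case 1 then show ?thesis using n by (intro exI[of _ 1]) auto
    next
      case 2 then show ?thesis by (intro exI[of _ i]) auto
    qed
  qed
  have "x > 0" using xyz by simp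
  obtain i where i: "1 \<le> i" "i \<le> n" "x = a + (i - 1) * d" using form[OF xyz(1) \<open>x > 0\<close>] by auto
  obtain j where j: "y = a + (j - 1) * d" using form[OF xyz(2,4)] by auto
  obtain k where k: "z = a + (k - 1) * d" using form[OF xyz(3,5)] by auto
  \<comment> \<open>Cancelling one \<open>a\<close> shows that \<open>a\<close> is a multiple of
    \<open>d\<close>, so \<open>d = 1\<close> by coprimality, and then
    \<open>a <= i - 1 < n\<close>.\<close>
  have "(i - 1) * d = a + (j - 1) * d + (k - 1) * d" using xyz(6) i j k by linarith
  then have eq: "a = (i - 1) * d - ((j - 1) * d + (k - 1) * d)" by linarith
  then have eq: "a = (i - 1 - (j - 1 + (k - 1))) * d"
    by (simp only: diff_mult_distrib add_mult_distrib)
  then have "d = 1" by (intro dvd) simp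
  with eq have "a = i - 1 - (j - 1 + (k - 1))" by simp
  with i have "n > a" by linarith
  with \<open>h = 1\<close> \<open>d = 1\<close> show ?thesis by simp
qed

section \<open>The characterization of Koszul curves\<close>

theorem theorem4p1:
  fixes n :: nat and m :: "nat \<Rightarrow> nat"
  assumes "infinite (UNIV :: 'k::field set)"
    and "n \<ge> 2"
    and "\<forall>i\<in>{1..n}. m i > 0"
    and "strict_mono_on {1..n} m"
    and "generalized_arithmetic_sequence n m"
  shows "koszul_algebra (curve_algebra n m :: 'k mpol set ring) (curve_grading n m)
    \<longleftrightarrow> (\<forall>i\<in>{1..<n}. m (i + 1) = m i + 1) \<and> n > m 1"
proof -
  let ?A = "curve_algebra n m :: 'k mpol set ring" and ?G = "curve_grading n m :: nat \<Rightarrow> 'k mpol set set"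
  let ?\<phi> = "curve_iso n m :: 'k mpol set \<Rightarrow> _"
  define E where "E = insert 0 (m ` {1..n})"
  have mono: "m i \<le> m j" if "1 \<le> i" "i \<le> j" "j \<le> n" for i j
    using strict_mono_onD[OF assms(4), of i j] that by (cases "i = j") auto
  have le: "\<forall>i\<in>{1..n}. m i \<le> m n" using mono assms(2) by auto
  have pos: "m n > 0" using assms(2,3) by auto
  note iso = curve_iso[where 'k='k, OF le pos, folded E_def]
  obtain h d where hd: "h > 0" "d > 0" "\<And>i. 2 \<le> i \<Longrightarrow> i \<le> n \<Longrightarrow> m i = h * m 1 + (i - 1) * d" "gcd (m 1) d = 1"
    using assms(5) unfolding generalized_arithmetic_sequence_def by auto
  show ?thesis
  proof
    assume koszul: "koszul_algebra ?A ?G"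
    have es: "set (0 # map m [1..<Suc n]) = E" by (auto simp: E_def)
    have "quadratically_connected E"
      unfolding quadratically_connected_def
      using koszul_quad_conn[OF koszul es iso] by blast
    moreover have "E = {0, m 1} \<union> (\<lambda>i. h * m 1 + (i - 1) * d) ` {2..n}"
    proof -
      have "{1..n} = insert 1 {2..n}" using assms(2) by auto
      moreover have "m ` {2..n} = (\<lambda>i. h * m 1 + (i - 1) * d) ` {2..n}"
        by (intro image_cong HOL.refl hd(3)) auto
      ultimately show ?thesis by (simp add: E_def)
    qed
    ultimately have *: "h = 1 \<and> d = 1 \<and> n > m 1"
      using assms(2,3) hd by (intro quadratically_connected_arithmetic) auto
    have "m (i + 1) = m i + 1" if "i \<in> {1..<n}" for i
      using hd(3)[of "i + 1"] hd(3)[of i] * that by (cases "i = 1") auto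
    with * show "(\<forall>i\<in>{1..<n}. m (i + 1) = m i + 1) \<and> n > m 1" by blast
  next
    assume *: "(\<forall>i\<in>{1..<n}. m (i + 1) = m i + 1) \<and> n > m 1"
    have eq: "m (Suc i) = m 1 + i" if "i < n" for i
      using that
    proof (induction i)
      case (Suc i)
      then show ?case using *[THEN conjunct1, rule_format, of "Suc i"] by simp
    qed simp
    have D: "m n = m 1 + (n - 1)" using eq[of "n - 1"] assms(2) by simp
    have "E = insert 0 {m 1..m n}"
    proof -
      have "m ` {1..n} = {m 1..m n}"
      proof (intro equalityI subsetI)
        fix x assume "x \<in> {m 1..m n}"
        then have "x = m (Suc (x - m 1))" "Suc (x - m 1) \<in> {1..n}" using eq[of "x - m 1"] D assms(2) by auto
        then show "x \<in> m ` {1..n}" by blast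
      qed (use mono assms(2) in auto)
      then show ?thesis by (simp add: E_def)
    qed
    moreover have "m 1 \<ge> 1" using assms(2,3) by (simp add: Suc_le_eq)
    \<comment> \<open>As \<open>m n = m 1 + (n - 1)\<close>, the condition \<open>n > m 1\<close> is
      exactly this inequality.\<close>
    moreover have "2 * m 1 \<le> m n" using D *[THEN conjunct2] by linarith
    ultimately show "koszul_algebra ?A ?G"
      by (intro koszul_algebra_interval[OF _ _ _ iso])
  qed
qed

end
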